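(* Let $n\ge 1$, $1\le p<\infty$, and let $\mathcal F$ be a family of functions in $W^{1,p}(\mathbb{R}^n)$. Assume: (i) there exist $C>0$ and $1<q<\infty$ such that $\|f\|_{L^p(\mathbb{R}^n)}+\|\nabla f\|_{q,\infty}\le C$ for all $f\in\mathcal F$; (ii) for every $\varepsilon>0$ there exists $R>0$ such that $\int_{|x|>R}\min(|f(x)|,1)^p\,dx<\varepsilon^p$ for all $f\in\mathcal F$. Then $\mathcal F$ is totally bounded in $\Lambda^p(\mathbb{R}^n)$.
   Context: $\Lambda^p(\mathbb{R}^n)$ is the set of measurable $u:\mathbb{R}^n\to\mathbb{R}$ with $\int_{\mathbb{R}^n}\min(|u|,1)^p\,dx<\infty$, equipped with the metric $d(u,v)=\bigl(\int_{\mathbb{R}^n}\min(|u-v|,1)^p\,dx\bigr)^{1/p}$. For a measurable (vector-valued) $h$, $\|h\|_{q,\infty}=\sup_{\lambda>0}\lambda\,|\{x:|h(x)|>\lambda\}|^{1/q}$ (weak $L^q$ quasi-norm). *)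

theory Defs
  imports "HOL-Analysis.Analysis"
begin

definition Lp_fun :: "real \<Rightarrow> ('a::euclidean_space \<Rightarrow> real) \<Rightarrow> bool" where
  "Lp_fun p f \<longleftrightarrow> f \<in> borel_measurable lebesgue \<and>
     (\<integral>\<^sup>+ x. ennreal (\<bar>f x\<bar> powr p) \<partial>lebesgue) < \<infinity>"

(* L^p norm (meaningful for f in L^p) *)
definition Lp_norm :: "real \<Rightarrow> ('a::euclidean_space \<Rightarrow> real) \<Rightarrow> real" where
  "Lp_norm p f = (enn2real (\<integral>\<^sup>+ x. ennreal (\<bar>f x\<bar> powr p) \<partial>lebesgue)) powr (1 / p)"

fun Ck :: "nat \<Rightarrow> ('a::euclidean_space \<Rightarrow> real) set" where
  "Ck 0 = {f. continuous_on UNIV f}"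
| "Ck (Suc k) = {f. f differentiable_on UNIV \<and>
      (\<forall>v. (\<lambda>x. frechet_derivative f (at x) v) \<in> Ck k)}"

definition test_fun :: "('a::euclidean_space \<Rightarrow> real) \<Rightarrow> bool" where
  "test_fun \<phi> \<longleftrightarrow> (\<forall>k. \<phi> \<in> Ck k) \<and> compact (closure {x. \<phi> x \<noteq> 0})"

definition weak_gradient :: "('a::euclidean_space \<Rightarrow> real) \<Rightarrow> ('a \<Rightarrow> 'a) \<Rightarrow> bool" where
  "weak_gradient f g \<longleftrightarrow> g \<in> borel_measurable lebesgue \<and>
     (\<forall>\<phi>. test_fun \<phi> \<longrightarrow> (\<forall>i\<in>Basis.
        (\<integral>x. f x * frechet_derivative \<phi> (at x) i \<partial>lebesgue)
          = - (\<integral>x. (g x \<bullet> i) * \<phi> x \<partial>lebesgue)))"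

definition W1p :: "real \<Rightarrow> ('a::euclidean_space \<Rightarrow> real) \<Rightarrow> bool" where
  "W1p p f \<longleftrightarrow> Lp_fun p f \<and>
     (\<exists>g. weak_gradient f g \<and> (\<forall>i\<in>Basis. Lp_fun p (\<lambda>x. g x \<bullet> i)))"

definition weak_Lq_norm :: "real \<Rightarrow> ('a::euclidean_space \<Rightarrow> 'b::real_normed_vector) \<Rightarrow> ereal" where
  "weak_Lq_norm q h = (SUP t\<in>{0<..}.
     (if emeasure lebesgue {x. norm (h x) > t} = \<infinity> then \<infinity>
      else ereal (t * (measure lebesgue {x. norm (h x) > t}) powr (1 / q))))"

definition Lambda_dist :: "real \<Rightarrow> ('a::euclidean_space \<Rightarrow> real) \<Rightarrow> ('a \<Rightarrow> real) \<Rightarrow> real" where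
  "Lambda_dist p u v =
     (enn2real (\<integral>\<^sup>+ x. ennreal (min \<bar>u x - v x\<bar> 1 powr p) \<partial>lebesgue)) powr (1 / p)"

definition Lambda_totally_bounded :: "real \<Rightarrow> ('a::euclidean_space \<Rightarrow> real) set \<Rightarrow> bool" where
  "Lambda_totally_bounded p F \<longleftrightarrow>
     (\<forall>e>0. \<exists>K. finite K \<and> K \<subseteq> F \<and> (\<forall>f\<in>F. \<exists>k\<in>K. Lambda_dist p f k < e))"

end

theory Submission
  imports Defs "HOL-Complex_Analysis.Great_Picard"
begin

text \<open>
  Since \<open>p \<ge> 1\<close>, we have \<open>min(|u|,1)^p \<le> |u|\<close>; hence, by the tail hypothesis, it suffices to find, in
  any sequence from the family, two members that are close in \<open>L^1\<close> of a large ball. As \<open>q > 1\<close>, the weak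
  \<open>L^q\<close> bound controls the gradients in \<open>L^1\<close> of balls. Testing \<open>f(x+h) - f(x)\<close> against its own sign, an
  almost everywhere limit of test functions, turns this into \<open>\<integral>|f(x+h) - f(x)| dx \<le> 2 |h| \<integral>|\<nabla>f|\<close> on
  balls. Therefore mollification moves the members of the family uniformly little in \<open>L^1\<close>, while the
  mollified functions are bounded and equi-Lipschitz, so that the Arzela-Ascoli theorem applies.
\<close>

section \<open>Test functions supported in a ball\<close>

text \<open>Weak gradients are accessible only through integrals against test functions, so an
  explicit class of test functions is needed that can be differentiated by hand and is still rich
  enough to approximate a sign. Polynomials times
  \<open>exp (- inverse (R\<^sup>2 - x \<bullet> x))\<close> do both: differentiation only raises a
  power of the denominator, and Stone-Weierstrass supplies the polynomials. The pairing of f with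
  \<phi>(x - h) - \<phi>(x) becomes a pairing of the gradient with translates of \<phi>, by
  integrating the directional derivative along the segment and exchanging integrals. The resulting
  bound involves sup |\<phi>| but no derivative of \<phi>; this is what permits the passage to a
  discontinuous sign. The factor 2 is the sup bound of the approximants. No limit in \<Lambda>^p is
  constructed: failure of total boundedness yields an infinite separated sequence, and one close
  pair in it is a contradiction.\<close>

lemma real_polynomial_function_has_derivative:
  fixes P :: "'a::real_normed_vector \<Rightarrow> real"
  assumes "real_polynomial_function P"
  shows "\<exists>P'. (\<forall>x. (P has_derivative (\<lambda>v. P' v x)) (at x)) \<and> (\<forall>v. real_polynomial_function (P' v))"
  using assms
proof (induction P rule: real_polynomial_function.induct)
  case (linear f)
  then show ?case
    by (intro exI[of _ "\<lambda>v x. f v"]) (auto intro: bounded_linear_imp_has_derivative)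
next
  case (const c)
  show ?case
    by (intro exI[of _ "\<lambda>v x. 0"]) auto
next
  case (add f g)
  then obtain f' g' where
    "\<forall>x. (f has_derivative (\<lambda>v. f' v x)) (at x)" "\<forall>v. real_polynomial_function (f' v)"
    "\<forall>x. (g has_derivative (\<lambda>v. g' v x)) (at x)" "\<forall>v. real_polynomial_function (g' v)"
    by blast
  then show ?case
    by (intro exI[of _ "\<lambda>v x. f' v x + g' v x"]) (auto intro!: has_derivative_add)
next
  case (mult f g)
  then obtain f' g' where
    "\<forall>x. (f has_derivative (\<lambda>v. f' v x)) (at x)" "\<forall>v. real_polynomial_function (f' v)"
    "\<forall>x. (g has_derivative (\<lambda>v. g' v x)) (at x)" "\<forall>v. real_polynomial_function (g' v)"
    by blast
  with mult.hyps show ?case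
    by (intro exI[of _ "\<lambda>v x. f x * g' v x + f' v x * g x"])
      (auto intro!: has_derivative_mult real_polynomial_function.intros(3,4))
qed

lemma real_polynomial_function_inner_self:
  "real_polynomial_function (\<lambda>x::'a::euclidean_space. x \<bullet> x)"
  unfolding euclidean_inner[of "x::'a" "x::'a" for x]
  by (intro real_polynomial_function_sum real_polynomial_function.intros(1,4)
      bounded_linear_inner_left) auto

text \<open>
  For fixed \<open>R\<close> this family, with \<open>m\<close> and the polynomial \<open>P\<close> varying, is closed under directional
  derivatives; its members are therefore smooth, without any calculus of smooth functions.
\<close>
definition bump :: "real \<Rightarrow> nat \<Rightarrow> ('a::euclidean_space \<Rightarrow> real) \<Rightarrow> 'a \<Rightarrow> real" where
  "bump R m P x = (if norm x < R
     then P x * inverse (R\<^sup>2 - x \<bullet> x) ^ m * exp (- inverse (R\<^sup>2 - x \<bullet> x)) else 0)"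

lemma norm_less_imp_inner_less: "norm x < R \<Longrightarrow> x \<bullet> x < R\<^sup>2"
  by (metis dot_square_norm norm_ge_zero pos2 power_strict_mono)

text \<open>A single term of the exponential series gives \<open>s ^ k \<le> fact k * exp s\<close>;
  it is used with \<open>s = inverse t\<close> and \<open>k = m + 2\<close>. The two extra powers
  leave the factor \<open>t\<^sup>2\<close>, which yields differentiability of bumps at the boundary
  sphere.\<close>

lemma inverse_power_exp_le:
  fixes t :: real
  assumes "t > 0"
  shows "inverse t ^ m * exp (- inverse t) \<le> fact (m + 2) * t\<^sup>2"
proof -
  have le: "s ^ k \<le> fact k * exp s" if "s \<ge> 0" for s :: real and k
    using sums_le[OF _ sums_If_finite_set[of "{k}" "\<lambda>n. s ^ n /\<^sub>R fact n"] exp_converges[of s]] that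
    by (simp add: field_simps)
  have "inverse t ^ (m + 2) * exp (- inverse t) \<le> fact (m + 2) * exp (inverse t) * exp (- inverse t)"
    using assms by (intro mult_right_mono le) auto
  then have "inverse t ^ (m + 2) * exp (- inverse t) \<le> fact (m + 2)"
    by (simp only: mult.assoc exp_add[symmetric]) simp
  then have "inverse t ^ (m + 2) * exp (- inverse t) * t\<^sup>2 \<le> fact (m + 2) * t\<^sup>2"
    by (intro mult_right_mono) auto
  moreover have "inverse t ^ m * exp (- inverse t) = inverse t ^ (m + 2) * exp (- inverse t) * t\<^sup>2"
    using assms by (simp add: power_add power2_eq_square field_simps)
  ultimately show ?thesis by (simp only:)
qed

text \<open>Product rule with w = \<open>R\<^sup>2 - x \<bullet> x\<close>, whose derivative in
  direction \<open>v\<close> is \<open>- 2 * (x \<bullet> v)\<close>. The three terms have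
  denominators w^m, w^(m+1) and w^(m+2); bringing them to the last one produces the factors w^2, w
  and 1 in the new polynomial.\<close>

lemma bump_has_derivative_inside:
  fixes P :: "'a::euclidean_space \<Rightarrow> real"
  assumes P: "(P has_derivative (\<lambda>v. P' v x)) (at x)" and x: "norm x < R"
  shows "(bump R m P has_derivative
    (\<lambda>v. bump R (m + 2) (\<lambda>x. P' v x * (R\<^sup>2 - x \<bullet> x)\<^sup>2
       + P x * (real m * (R\<^sup>2 - x \<bullet> x) * (2 * (x \<bullet> v)) - 2 * (x \<bullet> v))) x)) (at x)"
proof -
  let ?w = "\<lambda>x::'a. R\<^sup>2 - x \<bullet> x"
  have w: "?w x \<noteq> 0" using norm_less_imp_inner_less[OF x] by auto
  have dw: "(?w has_derivative (\<lambda>v. - 2 * (x \<bullet> v))) (at x)"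
    by (auto intro!: derivative_eq_intros simp: inner_commute)
  have dinv: "((\<lambda>x. inverse (?w x)) has_derivative (\<lambda>v. inverse (?w x)^2 * (2 * (x \<bullet> v)))) (at x)"
    by (rule derivative_eq_intros dw w refl)+ (auto simp: power2_eq_square fun_eq_iff)
  have dpow: "((\<lambda>x. inverse (?w x) ^ m) has_derivative
      (\<lambda>v. real m * inverse (?w x)^(m+1) * (2 * (x \<bullet> v)))) (at x)"
    by (rule derivative_eq_intros dinv refl)+
      (cases m; auto simp: power2_eq_square fun_eq_iff algebra_simps)
  have dexp: "((\<lambda>x. exp (- inverse (?w x))) has_derivative
      (\<lambda>v. - (exp (- inverse (?w x)) * inverse (?w x)^2 * (2 * (x \<bullet> v))))) (at x)"
    by (rule derivative_eq_intros dinv refl)+ (auto simp: fun_eq_iff)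
  have D: "((\<lambda>x. P x * inverse (?w x) ^ m * exp (- inverse (?w x))) has_derivative
    (\<lambda>v. bump R (m + 2) (\<lambda>x. P' v x * (R\<^sup>2 - x \<bullet> x)\<^sup>2
       + P x * (real m * (R\<^sup>2 - x \<bullet> x) * (2 * (x \<bullet> v)) - 2 * (x \<bullet> v))) x)) (at x)"
  proof (rule has_derivative_eq_rhs[OF has_derivative_mult[OF has_derivative_mult[OF P dpow] dexp]])
    define u where "u = inverse (?w x)"
    have uw: "?w x = inverse u" "u \<noteq> 0" using w by (auto simp: u_def)
    show "(\<lambda>h. P x * inverse (?w x) ^ m * - (exp (- inverse (?w x)) * (inverse (?w x))\<^sup>2 * (2 * (x \<bullet> h))) +
         (P x * (real m * inverse (?w x) ^ (m + 1) * (2 * (x \<bullet> h))) + P' h x * inverse (?w x) ^ m) *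
         exp (- inverse (?w x))) = (\<lambda>v. bump R (m + 2) (\<lambda>x. P' v x * (R\<^sup>2 - x \<bullet> x)\<^sup>2
       + P x * (real m * (R\<^sup>2 - x \<bullet> x) * (2 * (x \<bullet> v)) - 2 * (x \<bullet> v))) x)"
      using x uw unfolding bump_def uw
      by (auto simp: fun_eq_iff field_simps power2_eq_square power_add)
  qed
  show ?thesis
    by (rule has_derivative_transform_within_open[OF D open_ball[of 0 R]])
      (use x in \<open>auto simp: bump_def\<close>)
qed

lemma bump_le:
  fixes P :: "'a::euclidean_space \<Rightarrow> real"
  assumes "real_polynomial_function P"
  obtains A where "A \<ge> 0" "\<And>x. norm x < R \<Longrightarrow> \<bar>bump R m P x\<bar> \<le> A * (R\<^sup>2 - x \<bullet> x)\<^sup>2"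
proof -
  have "bounded (P ` cball 0 R)"
    by (intro compact_imp_bounded compact_continuous_image continuous_on_polymonial_function)
      (use assms in \<open>auto simp: real_polynomial_function_eq\<close>)
  then obtain B where B: "B > 0" "\<And>x. norm x \<le> R \<Longrightarrow> \<bar>P x\<bar> \<le> B"
    unfolding bounded_pos by auto
  have "\<bar>bump R m P x\<bar> \<le> (B * fact (m + 2)) * (R\<^sup>2 - x \<bullet> x)\<^sup>2" if x: "norm x < R" for x
  proof -
    have "R\<^sup>2 - x \<bullet> x > 0" using norm_less_imp_inner_less[OF x] by simp
    then have "\<bar>P x\<bar> * (inverse (R\<^sup>2 - x \<bullet> x) ^ m * exp (- inverse (R\<^sup>2 - x \<bullet> x)))
        \<le> B * (fact (m + 2) * (R\<^sup>2 - x \<bullet> x)\<^sup>2)"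
      using x B by (intro mult_mono inverse_power_exp_le) auto
    then show ?thesis using x \<open>R\<^sup>2 - x \<bullet> x > 0\<close> by (simp add: bump_def abs_mult mult.assoc)
  qed
  with B show ?thesis by (intro that[of "B * fact (m + 2)"]) auto
qed

text \<open>The points of the sphere itself are the delicate ones. For
  \<open>norm y < R \<le> norm x\<close> the quantity \<open>R\<^sup>2 - y \<bullet> y\<close> is at
  most \<open>norm (y - x) * (2 * norm x)\<close>, so the bump is bounded by a multiple of
  \<open>(norm (y - x))\<^sup>2\<close> and its difference quotient tends to 0. Exterior points are
  covered by the same estimate.\<close>

lemma bump_has_derivative_outside:
  fixes P :: "'a::euclidean_space \<Rightarrow> real"
  assumes P: "real_polynomial_function P" and x: "norm x \<ge> R"
  shows "(bump R m P has_derivative (\<lambda>v. 0)) (at x)"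
proof -
  obtain A where A: "A \<ge> 0" "\<And>y. norm y < R \<Longrightarrow> \<bar>bump R m P y\<bar> \<le> A * (R\<^sup>2 - y \<bullet> y)\<^sup>2"
    using bump_le[OF P] by blast
  define K where "K = A * (2 * norm x)\<^sup>2"
  have K: "\<bar>bump R m P y\<bar> \<le> K * (norm (y - x))\<^sup>2" for y
  proof (cases "norm y < R")
    case True
    have R: "R > 0" using True norm_ge_zero[of y] by linarith
    have "R\<^sup>2 - y \<bullet> y \<le> (norm x)\<^sup>2 - (norm y)\<^sup>2"
      using x R by (simp add: dot_square_norm power_mono)
    also have "\<dots> = (norm x - norm y) * (norm x + norm y)"
      by (simp add: power2_eq_square algebra_simps)
    also have "\<dots> \<le> norm (y - x) * (2 * norm x)"
      using True x norm_triangle_ineq2[of x y] norm_minus_commute[of x y] by (intro mult_mono) auto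
    finally have "(R\<^sup>2 - y \<bullet> y)\<^sup>2 \<le> (norm (y - x) * (2 * norm x))\<^sup>2"
      using norm_less_imp_inner_less[OF True] by (intro power_mono) auto
    then have "A * (R\<^sup>2 - y \<bullet> y)\<^sup>2 \<le> A * (norm (y - x) * (2 * norm x))\<^sup>2"
      using A(1) by (rule mult_left_mono)
    then show ?thesis using A(2)[OF True] by (simp add: K_def power_mult_distrib mult_ac)
  next
    case False
    then show ?thesis using A(1) by (simp add: bump_def K_def)
  qed
  have "((\<lambda>y. K * norm (y - x)) \<longlongrightarrow> K * norm (x - x)) (at x)"
    by (intro tendsto_intros)
  then have lim: "((\<lambda>y. K * norm (y - x)) \<longlongrightarrow> 0) (at x)" by simp
  have "((\<lambda>y. \<bar>bump R m P y\<bar> / norm (y - x)) \<longlongrightarrow> 0) (at x)"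
  proof (rule tendsto_sandwich[OF _ _ tendsto_const lim])
    show "\<forall>\<^sub>F y in at x. \<bar>bump R m P y\<bar> / norm (y - x) \<le> K * norm (y - x)"
      by (auto simp: eventually_at_filter field_simps power2_eq_square intro!: always_eventually order_trans[OF K])
  qed auto
  moreover have "bump R m P x = 0" using x by (simp add: bump_def)
  ultimately show ?thesis
    by (auto simp: has_derivative_iff_norm)
qed

text \<open>The inside formula is valid everywhere, since outside the ball both the derivative and
  every bump are 0. The radius is unchanged and the new factor is again polynomial, so this step can
  be iterated.\<close>

lemma bump_derivative_is_bump:
  fixes P :: "'a::euclidean_space \<Rightarrow> real"
  assumes "real_polynomial_function P"
  shows "\<exists>P'. (\<forall>v. real_polynomial_function (P' v)) \<and>
    (\<forall>x. (bump R m P has_derivative (\<lambda>v. bump R (m + 2) (P' v) x)) (at x))"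
proof -
  obtain P' where P': "\<forall>x. (P has_derivative (\<lambda>v. P' v x)) (at x)" "\<forall>v. real_polynomial_function (P' v)"
    using real_polynomial_function_has_derivative[OF assms] by blast
  let ?Q = "\<lambda>v x. P' v x * (R\<^sup>2 - x \<bullet> x)\<^sup>2
       + P x * (real m * (R\<^sup>2 - x \<bullet> x) * (2 * (x \<bullet> v)) - 2 * (x \<bullet> v))"
  have lin: "real_polynomial_function (\<lambda>x::'a. x \<bullet> v)" for v
    by (intro real_polynomial_function.intros(1) bounded_linear_inner_left)
  have "real_polynomial_function (?Q v)" for v
    using P'(2) assms real_polynomial_function_inner_self lin
    by (intro real_polynomial_function.intros(2-) real_polynomial_function_power
        real_polynomial_function_diff) auto
  moreover have "(bump R m P has_derivative (\<lambda>v. bump R (m + 2) (?Q v) x)) (at x)" for x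
  proof (cases "norm x < R")
    case True
    then show ?thesis using bump_has_derivative_inside P'(1) by blast
  next
    case False
    have "(\<lambda>v. bump R (m + 2) (?Q v) x) = (\<lambda>v. 0)" using False by (simp add: bump_def)
    then show ?thesis using bump_has_derivative_outside[OF assms, of R x m] False by simp
  qed
  ultimately show ?thesis by (intro exI[of _ ?Q]) auto
qed

text \<open>The induction has to range over all \<open>m\<close> and \<open>P\<close>, as
  differentiation changes both.\<close>

lemma bump_shift_in_Ck:
  fixes P :: "'a::euclidean_space \<Rightarrow> real"
  assumes "real_polynomial_function P"
  shows "(\<lambda>x. bump R m P (x - a)) \<in> Ck k"
  using assms
proof (induction k arbitrary: m P)
  case (0 m P)
  obtain P' where "\<forall>x. (bump R m P has_derivative (\<lambda>v. bump R (m + 2) (P' v) x)) (at x)"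
    using bump_derivative_is_bump[OF 0] by blast
  then have "continuous_on UNIV (bump R m P)"
    by (auto simp: continuous_on_eq_continuous_at intro: has_derivative_continuous)
  then show ?case
    by (auto intro!: continuous_on_compose2[of UNIV "bump R m P"] continuous_intros)
next
  case (Suc k m P)
  obtain P' where P': "\<forall>v. real_polynomial_function (P' v)"
    "\<And>x. (bump R m P has_derivative (\<lambda>v. bump R (m + 2) (P' v) x)) (at x)"
    using bump_derivative_is_bump[OF Suc.prems] by blast
  have D: "((\<lambda>x. bump R m P (x - a)) has_derivative (\<lambda>v. bump R (m + 2) (P' v) (x - a))) (at x)" for x
    by (rule has_derivative_compose[OF _ P'(2), of "\<lambda>x. x - a" "\<lambda>x. x"])
      (auto intro!: derivative_eq_intros)
  have "frechet_derivative (\<lambda>x. bump R m P (x - a)) (at x) = (\<lambda>v. bump R (m + 2) (P' v) (x - a))" for x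
    by (rule frechet_derivative_at[OF D, symmetric])
  with D Suc.IH P'(1) show ?case
    by (auto simp: differentiable_on_def differentiable_def intro: has_derivative_at_withinI)
qed

lemma test_fun_bump_shift:
  fixes P :: "'a::euclidean_space \<Rightarrow> real"
  assumes "real_polynomial_function P"
  shows "test_fun (\<lambda>x. bump R m P (x - a))"
proof -
  have "{x. bump R m P (x - a) \<noteq> 0} \<subseteq> cball a R"
    by (auto simp: bump_def dist_norm norm_minus_commute)
  then show ?thesis
    unfolding test_fun_def
    by (auto intro: bump_shift_in_Ck[OF assms] bounded_subset)
qed

section \<open>Weak gradients and translations\<close>

lemma continuous_on_bump:
  fixes P :: "'a::euclidean_space \<Rightarrow> real"
  assumes "real_polynomial_function P"
  shows "continuous_on A (bump R m P)"
proof -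
  have "(\<lambda>x. bump R m P (x - 0)) \<in> Ck 0"
    by (rule bump_shift_in_Ck[OF assms])
  then show ?thesis by (auto intro: continuous_on_subset)
qed

lemma bump_eq_0: "norm x \<ge> R \<Longrightarrow> bump R m P x = 0"
  by (simp add: bump_def)

lemma bump_bounded:
  fixes P :: "'a::euclidean_space \<Rightarrow> real"
  assumes "real_polynomial_function P"
  obtains B where "B \<ge> 0" "\<And>x. \<bar>bump R m P x\<bar> \<le> B"
proof -
  have "bounded (bump R m P ` cball 0 R)"
    by (intro compact_imp_bounded compact_continuous_image continuous_on_bump assms) auto
  then obtain B where "B > 0" "\<And>x. norm x \<le> R \<Longrightarrow> \<bar>bump R m P x\<bar> \<le> B"
    unfolding bounded_pos by auto
  then have "\<bar>bump R m P x\<bar> \<le> B" for x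
    by (cases "norm x \<le> R") (auto simp: bump_eq_0)
  with \<open>B > 0\<close> show ?thesis
    by (intro that[of B]) auto
qed

lemma borel_measurable_bump [measurable]:
  "real_polynomial_function P \<Longrightarrow> bump R m P \<in> borel_measurable borel"
  by (intro borel_measurable_continuous_onI continuous_on_bump)

lemma borel_measurable_lebesgueI: "f \<in> borel_measurable borel \<Longrightarrow> f \<in> borel_measurable lebesgue"
  by (intro measurable_completion) simp

lemma nn_integral_abs_mult_le:
  fixes f u :: "'a \<Rightarrow> real"
  assumes [measurable]: "f \<in> borel_measurable M" "S \<in> sets M"
    and u: "\<And>x. x \<in> space M \<Longrightarrow> \<bar>u x\<bar> \<le> B" "\<And>x. x \<in> space M \<Longrightarrow> x \<notin> S \<Longrightarrow> u x = 0" and B: "0 \<le> B"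
  shows "(\<integral>\<^sup>+x. ennreal \<bar>f x * u x\<bar> \<partial>M) \<le> ennreal B * (\<integral>\<^sup>+x\<in>S. ennreal \<bar>f x\<bar> \<partial>M)"
proof -
  have "(\<integral>\<^sup>+x. ennreal \<bar>f x * u x\<bar> \<partial>M) \<le> (\<integral>\<^sup>+x. ennreal B * (ennreal \<bar>f x\<bar> * indicator S x) \<partial>M)"
    using u B by (intro nn_integral_mono)
      (auto simp: indicator_def abs_mult ennreal_mult[symmetric] mult.commute[of B] intro!: ennreal_leI mult_left_mono)
  then show ?thesis by (simp add: nn_integral_cmult)
qed

text \<open>The form in which local integrability is used: \<open>S\<close> is a ball,
  \<open>f\<close> is a function or a gradient component with known integral over it, and
  \<open>u\<close> is a bounded factor (bump, sign, kernel) supported there.\<close>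

lemma integrable_mult_bounded_support:
  fixes f u :: "'a \<Rightarrow> real"
  assumes [measurable]: "f \<in> borel_measurable M" "u \<in> borel_measurable M" "S \<in> sets M"
    and u: "\<And>x. x \<in> space M \<Longrightarrow> \<bar>u x\<bar> \<le> B" "\<And>x. x \<in> space M \<Longrightarrow> x \<notin> S \<Longrightarrow> u x = 0" and B: "0 \<le> B"
    and f: "(\<integral>\<^sup>+x\<in>S. ennreal \<bar>f x\<bar> \<partial>M) \<le> ennreal I" and I: "0 \<le> I"
  shows "integrable M (\<lambda>x. f x * u x)" "\<bar>\<integral>x. f x * u x \<partial>M\<bar> \<le> B * I"
proof -
  have le: "(\<integral>\<^sup>+x. ennreal \<bar>f x * u x\<bar> \<partial>M) \<le> ennreal (B * I)"
    using order_trans[OF nn_integral_abs_mult_le[OF assms(1,3) u B] mult_left_mono[OF f]] B I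
    by (simp add: ennreal_mult)
  then show *: "integrable M (\<lambda>x. f x * u x)"
    by (intro integrableI_bounded) (auto simp: le_less_trans)
  have "ennreal \<bar>\<integral>x. f x * u x \<partial>M\<bar> \<le> (\<integral>\<^sup>+x. ennreal \<bar>f x * u x\<bar> \<partial>M)"
    using integral_norm_bound_ennreal[OF *] by simp
  also note le
  finally show "\<bar>\<integral>x. f x * u x \<partial>M\<bar> \<le> B * I"
    using B I by (simp add: ennreal_le_iff)
qed

text \<open>The definition of weak gradients covers only basis directions; linearity of the
  derivative in its direction gives all \<open>h\<close>. The condition on \<open>r\<close> keeps
  the shifted support inside the ball where \<open>f\<close> and \<open>g\<close> are integrable, so
  that the sums may be taken out of the integrals.\<close>

lemma weak_gradient_bump_shift:
  fixes f :: "'a::euclidean_space \<Rightarrow> real"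
  assumes f: "f \<in> borel_measurable lebesgue" "(\<integral>\<^sup>+x\<in>cball 0 r. ennreal \<bar>f x\<bar> \<partial>lebesgue) < \<infinity>"
    and g: "weak_gradient f g" "(\<integral>\<^sup>+x\<in>cball 0 r. ennreal (norm (g x)) \<partial>lebesgue) < \<infinity>"
    and P: "real_polynomial_function P" "\<And>v. real_polynomial_function (P' v)"
    and D: "\<And>x. (bump R m P has_derivative (\<lambda>v. bump R k (P' v) x)) (at x)"
    and r: "R + norm a \<le> r"
  shows "(\<integral>x. f x * bump R k (P' h) (x - a) \<partial>lebesgue) = - (\<integral>x. (g x \<bullet> h) * bump R m P (x - a) \<partial>lebesgue)"
proof -
  have meas: "(\<lambda>x. bump R m P (x - a)) \<in> borel_measurable lebesgue" if "real_polynomial_function P" for m P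
    using that by (intro borel_measurable_lebesgueI) measurable
  have supp: "bump R m P (x - a) = 0" if "x \<notin> cball 0 r" for m P x
    using that r norm_triangle_ineq2[of x a] by (intro bump_eq_0) auto
  have gm [measurable]: "g \<in> borel_measurable lebesgue" using g by (simp add: weak_gradient_def)
  have fI: "integrable lebesgue (\<lambda>x. f x * bump R m P (x - a))" if P: "real_polynomial_function P" for m P
  proof -
    obtain B where "B \<ge> 0" "\<And>x. \<bar>bump R m P x\<bar> \<le> B" using bump_bounded[OF P] by blast
    with f supp show ?thesis
      by (intro integrable_mult_bounded_support(1)[where S="cball 0 r" and B=B
            and I="enn2real (\<integral>\<^sup>+x\<in>cball 0 r. ennreal \<bar>f x\<bar> \<partial>lebesgue)"] meas P) auto
  qed
  have gI: "integrable lebesgue (\<lambda>x. (g x \<bullet> i) * bump R m P (x - a))" if "i \<in> Basis" for i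
  proof -
    obtain B where "B \<ge> 0" "\<And>x. \<bar>bump R m P x\<bar> \<le> B" using bump_bounded[OF P(1)] by blast
    moreover have "(\<integral>\<^sup>+x\<in>cball 0 r. ennreal \<bar>g x \<bullet> i\<bar> \<partial>lebesgue) \<le> (\<integral>\<^sup>+x\<in>cball 0 r. ennreal (norm (g x)) \<partial>lebesgue)"
      using that by (intro nn_integral_mono) (auto simp: indicator_def Basis_le_norm)
    then have "(\<integral>\<^sup>+x\<in>cball 0 r. ennreal \<bar>g x \<bullet> i\<bar> \<partial>lebesgue) < \<infinity>" using g(2) by (rule le_less_trans)
    ultimately show ?thesis using supp
      by (intro integrable_mult_bounded_support(1)[where S="cball 0 r" and B=B
            and I="enn2real (\<integral>\<^sup>+x\<in>cball 0 r. ennreal \<bar>g x \<bullet> i\<bar> \<partial>lebesgue)"] meas P) auto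
  qed
  \<comment> \<open>Nothing is assumed about how \<open>P'\<close> depends on its direction;
    linearity holds because these values form a derivative.\<close>
  have lin: "bump R k (P' h) y = (\<Sum>i\<in>Basis. (h \<bullet> i) * bump R k (P' i) y)" for y
  proof -
    have "linear (\<lambda>v. bump R k (P' v) y)" using D by (rule has_derivative_linear)
    from linear_sum[OF this, of "\<lambda>i. (h \<bullet> i) *\<^sub>R i" Basis]
    have "bump R k (P' (\<Sum>i\<in>Basis. (h \<bullet> i) *\<^sub>R i)) y = (\<Sum>i\<in>Basis. (h \<bullet> i) * bump R k (P' i) y)"
      by (simp add: linear_scale[OF \<open>linear _\<close>])
    then show ?thesis by (simp add: euclidean_representation)
  qed
  have D': "((\<lambda>x. bump R m P (x - a)) has_derivative (\<lambda>v. bump R k (P' v) (x - a))) (at x)" for x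
    by (rule has_derivative_compose[OF _ D, of "\<lambda>x. x - a" "\<lambda>x. x"])
      (auto intro!: derivative_eq_intros)
  have wg: "(\<integral>x. f x * bump R k (P' i) (x - a) \<partial>lebesgue) = - (\<integral>x. (g x \<bullet> i) * bump R m P (x - a) \<partial>lebesgue)"
    if "i \<in> Basis" for i
    using g(1) test_fun_bump_shift[OF P(1), of R m a] that
    by (auto simp: weak_gradient_def frechet_derivative_at[OF D', symmetric])
  have "(\<integral>x. f x * bump R k (P' h) (x - a) \<partial>lebesgue)
      = (\<integral>x. (\<Sum>i\<in>Basis. (h \<bullet> i) * (f x * bump R k (P' i) (x - a))) \<partial>lebesgue)"
    by (subst lin) (simp add: sum_distrib_left mult_ac)
  also have "\<dots> = (\<Sum>i\<in>Basis. (h \<bullet> i) * (\<integral>x. f x * bump R k (P' i) (x - a) \<partial>lebesgue))"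
    using fI P(2) by (subst Bochner_Integration.integral_sum) auto
  also have "\<dots> = - (\<Sum>i\<in>Basis. (h \<bullet> i) * (\<integral>x. (g x \<bullet> i) * bump R m P (x - a) \<partial>lebesgue))"
    by (simp add: wg sum_negf)
  also have "\<dots> = - (\<integral>x. (\<Sum>i\<in>Basis. (h \<bullet> i) * ((g x \<bullet> i) * bump R m P (x - a))) \<partial>lebesgue)"
    using gI by (subst Bochner_Integration.integral_sum) auto
  also have "\<dots> = - (\<integral>x. (g x \<bullet> h) * bump R m P (x - a) \<partial>lebesgue)"
    by (simp add: euclidean_inner[of "g _" h] sum_distrib_left mult_ac)
  finally show ?thesis .
qed

text \<open>With \<phi> the bump, \<phi>(x - h) - \<phi>(x) is minus the integral over t in [0,1] of
  the derivative in direction h at x - th. After Fubini, each inner integral is a pairing of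
  \<open>f\<close> with a derivative of a translated bump, which the weak gradient turns into a
  pairing of \<open>g \<bullet> h\<close> with the translated bump itself; that is at most
  \<open>B * norm h * J\<close>.\<close>

lemma translation_bump_le:
  fixes f :: "'a::euclidean_space \<Rightarrow> real"
  assumes f [measurable]: "f \<in> borel_measurable borel"
    and fI: "(\<integral>\<^sup>+x\<in>cball 0 r. ennreal \<bar>f x\<bar> \<partial>lborel) \<le> ennreal I" "0 \<le> I"
    and g: "weak_gradient f g" "(\<integral>\<^sup>+x\<in>cball 0 r. ennreal (norm (g x)) \<partial>lebesgue) \<le> ennreal J" "0 \<le> J"
    and P: "real_polynomial_function P" and B: "\<And>x. \<bar>bump R m P x\<bar> \<le> B"
    and r: "R + norm h \<le> r"
  shows "\<bar>\<integral>x. f x * (bump R m P (x - h) - bump R m P x) \<partial>lborel\<bar> \<le> B * norm h * J"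
proof -
  obtain P' where P': "\<And>v. real_polynomial_function (P' v)"
    and D: "\<And>x. (bump R m P has_derivative (\<lambda>v. bump R (m + 2) (P' v) x)) (at x)"
    using bump_derivative_is_bump[OF P] by blast
  define u where "u = bump R (m + 2) (P' h)"
  have cu: "continuous_on UNIV u" unfolding u_def by (rule continuous_on_bump[OF P'])
  have [measurable]: "u \<in> borel_measurable borel" using cu by (rule borel_measurable_continuous_onI)
  \<comment> \<open>The sup bound \<open>A\<close> of the derivative serves the integrability
    required by Fubini; it does not enter the final constant.\<close>
  obtain A where A: "A \<ge> 0" "\<And>x. \<bar>u x\<bar> \<le> A" unfolding u_def using bump_bounded[OF P'] by blast
  have B0: "B \<ge> 0" using B[of 0] by linarith
  have gm [measurable]: "g \<in> borel_measurable lebesgue" using g by (simp add: weak_gradient_def)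
  have lf: "f \<in> borel_measurable lebesgue" using f by (rule borel_measurable_lebesgueI)
  have [measurable]: "cball 0 r \<in> sets lebesgue" by simp
  \<comment> \<open>The whole segment of translates stays in the ball of radius \<open>r\<close>, so
    \<open>I\<close> and \<open>J\<close> serve for every \<open>t\<close>.\<close>
  have rt: "R + norm (t *\<^sub>R h) \<le> r" if "t \<in> {0..1}" for t
    using that r mult_right_mono[of t 1 "norm h"] by auto
  have supp: "bump R n Q (x - t *\<^sub>R h) = 0" if "t \<in> {0..1}" "x \<notin> cball 0 r" for n Q x t
    using that rt[OF that(1)] norm_triangle_ineq2[of x "t *\<^sub>R h"] by (intro bump_eq_0) auto

  have inner_eq: "(\<integral>x. f x * u (x - t *\<^sub>R h) \<partial>lborel) = - (\<integral>x. (g x \<bullet> h) * bump R m P (x - t *\<^sub>R h) \<partial>lebesgue)"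
    if t: "t \<in> {0..1}" for t
  proof -
    have "(\<integral>x. f x * u (x - t *\<^sub>R h) \<partial>lborel) = (\<integral>x. f x * u (x - t *\<^sub>R h) \<partial>lebesgue)"
      by (rule integral_completion[symmetric]) measurable
    also have "\<dots> = - (\<integral>x. (g x \<bullet> h) * bump R m P (x - t *\<^sub>R h) \<partial>lebesgue)"
      unfolding u_def using fI g P P' D rt[OF t]
      by (intro weak_gradient_bump_shift[OF lf, of r]) (auto simp: nn_integral_completion intro: le_less_trans)
    finally show ?thesis .
  qed
  have inner_le: "\<bar>\<integral>x. f x * u (x - t *\<^sub>R h) \<partial>lborel\<bar> \<le> B * (norm h * J)" if t: "t \<in> {0..1}" for t
  proof -
    have m: "(\<lambda>x. bump R m P (x - t *\<^sub>R h)) \<in> borel_measurable lebesgue"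
      using P by (intro borel_measurable_lebesgueI) measurable
    have "(\<integral>\<^sup>+x\<in>cball 0 r. ennreal \<bar>g x \<bullet> h\<bar> \<partial>lebesgue)
        \<le> (\<integral>\<^sup>+x. ennreal (norm h) * (ennreal (norm (g x)) * indicator (cball 0 r) x) \<partial>lebesgue)"
    proof (intro nn_integral_mono)
      fix x
      have "\<bar>g x \<bullet> h\<bar> \<le> norm h * norm (g x)"
        using Cauchy_Schwarz_ineq2[of "g x" h] by (simp add: mult.commute)
      then show "ennreal \<bar>g x \<bullet> h\<bar> * indicator (cball 0 r) x
          \<le> ennreal (norm h) * (ennreal (norm (g x)) * indicator (cball 0 r) x)"
        by (simp add: indicator_def ennreal_mult[symmetric])
    qed
    also have "\<dots> = ennreal (norm h) * (\<integral>\<^sup>+x\<in>cball 0 r. ennreal (norm (g x)) \<partial>lebesgue)"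
      by (intro nn_integral_cmult) measurable
    also have "\<dots> \<le> ennreal (norm h * J)"
      using g by (simp add: ennreal_mult mult_left_mono)
    finally have "\<bar>\<integral>x. (g x \<bullet> h) * bump R m P (x - t *\<^sub>R h) \<partial>lebesgue\<bar> \<le> B * (norm h * J)"
      using B B0 supp[OF t] g m
      by (intro integrable_mult_bounded_support(2)[where S="cball 0 r"]) auto
    then show ?thesis by (simp add: inner_eq[OF t])
  qed

  \<comment> \<open>Putting the indicator of the unit interval into the integrand lets Fubini be
    applied on the full product space.\<close>
  define G where "G t x = indicat_real {0..1} t * (f x * u (x - t *\<^sub>R h))" for t x
  have Gm [measurable]: "(\<lambda>(t, x). G t x) \<in> borel_measurable (lborel \<Otimes>\<^sub>M lborel)"
    unfolding G_def by measurable
  have Gint: "integrable (lborel \<Otimes>\<^sub>M lborel) (\<lambda>(t, x). G t x)"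
  proof (rule integrableI_bounded[OF Gm])
    have "(\<integral>\<^sup>+z. ennreal (norm (case z of (t, x) \<Rightarrow> G t x)) \<partial>(lborel \<Otimes>\<^sub>M lborel))
        = (\<integral>\<^sup>+t. \<integral>\<^sup>+x. ennreal \<bar>G t x\<bar> \<partial>lborel \<partial>lborel)"
      by (subst lborel.nn_integral_fst[symmetric]) (auto simp: case_prod_beta')
    also have "\<dots> \<le> (\<integral>\<^sup>+t. ennreal (A * I) * indicator {0..1::real} t \<partial>lborel)"
    proof (intro nn_integral_mono)
      fix t :: real
      show "(\<integral>\<^sup>+x. ennreal \<bar>G t x\<bar> \<partial>lborel) \<le> ennreal (A * I) * indicator {0..1} t"
      proof (cases "t \<in> {0..1}")
        case True
        have "(\<integral>\<^sup>+x. ennreal \<bar>f x * u (x - t *\<^sub>R h)\<bar> \<partial>lborel) \<le> ennreal A * (\<integral>\<^sup>+x\<in>cball 0 r. ennreal \<bar>f x\<bar> \<partial>lborel)"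
          using A supp[OF True] by (intro nn_integral_abs_mult_le) (auto simp: u_def)
        also have "\<dots> \<le> ennreal (A * I)" using fI A by (simp add: ennreal_mult mult_left_mono)
        finally show ?thesis using True by (simp add: G_def)
      qed (simp add: G_def)
    qed
    also have "\<dots> < \<infinity>" by (simp add: nn_integral_cmult ennreal_mult_less_top)
    finally show "(\<integral>\<^sup>+z. ennreal (norm (case z of (t, x) \<Rightarrow> G t x)) \<partial>(lborel \<Otimes>\<^sub>M lborel)) < \<infinity>" .
  qed

  have ftc: "(\<integral>t. G t x \<partial>lborel) = - (f x * (bump R m P (x - h) - bump R m P x))" for x
  proof -
    have "((\<lambda>t. - bump R m P (x - t *\<^sub>R h)) has_vector_derivative u (x - t *\<^sub>R h)) (at t within {0..1})" for t
    proof -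
      have "((\<lambda>t. bump R m P (x - t *\<^sub>R h)) has_derivative (\<lambda>s. bump R (m + 2) (P' (- (s *\<^sub>R h))) (x - t *\<^sub>R h))) (at t within {0..1})"
        by (rule has_derivative_compose[OF _ D, of "\<lambda>t. x - t *\<^sub>R h" "\<lambda>s. - (s *\<^sub>R h)"])
          (auto intro!: derivative_eq_intros)
      moreover have "bump R (m + 2) (P' (- (s *\<^sub>R h))) (x - t *\<^sub>R h) = s * - u (x - t *\<^sub>R h)" for s
      proof -
        have "linear (\<lambda>v. bump R (m + 2) (P' v) (x - t *\<^sub>R h))" using D by (rule has_derivative_linear)
        from linear_scale[OF this, of "- s" h] show ?thesis by (simp add: u_def)
      qed
      ultimately have "((\<lambda>t. bump R m P (x - t *\<^sub>R h)) has_vector_derivative - u (x - t *\<^sub>R h)) (at t within {0..1})"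
        by (simp add: has_vector_derivative_def)
      from has_vector_derivative_minus[OF this] show ?thesis by simp
    qed
    moreover have "continuous_on {0..1} (\<lambda>t. u (x - t *\<^sub>R h))"
      by (rule continuous_on_compose2[OF cu]) (auto intro!: continuous_intros)
    ultimately have "(\<integral>t. indicator {0..1} t *\<^sub>R u (x - t *\<^sub>R h) \<partial>lborel)
        = - bump R m P (x - 1 *\<^sub>R h) - (- bump R m P (x - 0 *\<^sub>R h))"
      by (intro integral_FTC_atLeastAtMost) auto
    then have "f x * (\<integral>t. indicator {0..1} t *\<^sub>R u (x - t *\<^sub>R h) \<partial>lborel)
       = - (f x * (bump R m P (x - h) - bump R m P x))"
      by (simp only: scaleR_one scaleR_zero_left diff_zero) (simp add: algebra_simps)
    moreover have "(\<integral>t. G t x \<partial>lborel) = f x * (\<integral>t. indicator {0..1} t *\<^sub>R u (x - t *\<^sub>R h) \<partial>lborel)"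
    proof -
      have "(\<lambda>t. G t x) = (\<lambda>t. f x * (indicator {0..1} t *\<^sub>R u (x - t *\<^sub>R h)))"
        by (auto simp: G_def)
      then show ?thesis by simp
    qed
    ultimately show ?thesis by simp
  qed
  have "- (\<integral>x. f x * (bump R m P (x - h) - bump R m P x) \<partial>lborel) = (\<integral>x. \<integral>t. G t x \<partial>lborel \<partial>lborel)"
    by (simp add: ftc)
  also have "\<dots> = (\<integral>t. \<integral>x. G t x \<partial>lborel \<partial>lborel)"
    by (rule lborel_pair.Fubini_integral[OF Gint])
  also have "\<bar>\<dots>\<bar> \<le> (\<integral>t. (B * (norm h * J)) * indicator {0..1::real} t \<partial>lborel)"
  proof (rule order_trans[OF integral_abs_bound])
    show "(\<integral>t. \<bar>\<integral>x. G t x \<partial>lborel\<bar> \<partial>lborel) \<le> (\<integral>t. (B * (norm h * J)) * indicator {0..1::real} t \<partial>lborel)"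
    proof (rule integral_mono)
      show "integrable lborel (\<lambda>t. \<bar>\<integral>x. G t x \<partial>lborel\<bar>)"
        using lborel_pair.integrable_fst'[OF Gint] by simp
      show "\<bar>\<integral>x. G t x \<partial>lborel\<bar> \<le> (B * (norm h * J)) * indicator {0..1} t" for t
        using inner_le[of t] by (auto simp: G_def indicator_def)
    qed simp
  qed
  finally show ?thesis by (simp add: mult.assoc)
qed

section \<open>Approximation by bumps, uniformly and almost everywhere\<close>

text \<open>The gap \<open>R0 < R\<close> is essential for the quotient:
  \<open>exp (inverse (R\<^sup>2 - x \<bullet> x))\<close> blows up at the sphere of radius
  \<open>R\<close>, but \<open>\<psi>\<close> vanishes beyond \<open>R0\<close>, so the quotient
  extends continuously by 0. Multiplying back by a factor at most 1 does not increase the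
  error.\<close>

lemma bump_approximates_continuous:
  fixes \<psi> :: "'a::euclidean_space \<Rightarrow> real"
  assumes \<psi>: "continuous_on UNIV \<psi>" "\<And>x. norm x > R0 \<Longrightarrow> \<psi> x = 0" and R: "R0 < R" and e: "e > 0"
  obtains P where "real_polynomial_function P" "\<And>x. \<bar>bump R 0 P x - \<psi> x\<bar> < e"
proof -
  let ?w = "\<lambda>x::'a. R\<^sup>2 - x \<bullet> x"
  \<comment> \<open>Dividing \<open>\<psi>\<close> by the bump with \<open>P = 1\<close> reduces the claim to polynomial approximation of \<open>q\<close>.\<close>
  define q where "q x = (if norm x < R then \<psi> x * exp (inverse (?w x)) else 0)" for x
  have "continuous_on (ball 0 R) (\<lambda>x. \<psi> x * exp (inverse (?w x)))"
    by (intro continuous_intros continuous_on_subset[OF \<psi>(1)]) (use norm_less_imp_inner_less in fastforce)+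
  then have 1: "continuous_on (ball 0 R) q"
    by (rule continuous_on_eq) (simp add: q_def)
  have "continuous_on (- cball 0 R0) (\<lambda>x::'a. 0::real)" by (rule continuous_on_const)
  then have 2: "continuous_on (- cball 0 R0) q"
    by (rule continuous_on_eq) (simp add: q_def \<psi>(2))
  have "ball 0 R \<union> - cball (0::'a) R0 = UNIV" using R by auto
  with continuous_on_open_Un[OF _ _ 1 2] have "continuous_on UNIV q" by (simp add: open_Compl)
  then obtain P where P: "real_polynomial_function P" "\<And>x. x \<in> cball 0 R \<Longrightarrow> \<bar>q x - P x\<bar> < e"
    using Stone_Weierstrass_real_polynomial_function[OF compact_cball[of 0 R] _ e, of q] continuous_on_subset by blast
  have "\<bar>bump R 0 P x - \<psi> x\<bar> < e" for x
  proof (cases "norm x < R")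
    case True
    have w: "?w x > 0" using norm_less_imp_inner_less[OF True] by simp
    have "\<psi> x = q x * exp (- inverse (?w x))" using True by (simp add: q_def exp_minus)
    then have "\<bar>bump R 0 P x - \<psi> x\<bar> = \<bar>q x - P x\<bar> * exp (- inverse (?w x))"
      using True by (simp add: bump_def abs_mult abs_minus_commute flip: left_diff_distrib)
    also have "\<dots> \<le> \<bar>q x - P x\<bar>" using w by (intro mult_right_le_one_le) auto
    also have "\<dots> < e" using P(2) True by simp
    finally show ?thesis .
  qed (use \<psi>(2) R e in \<open>simp add: bump_def\<close>)
  with P(1) show ?thesis by (rule that)
qed

text \<open>A Lebesgue measurable function is an almost everywhere limit of continuous functions.
  Truncating and cutting these off gives bounds and supports for uniform approximation by bumps. The
  bound 2 is 1 for the truncated function plus an error of at most 1.\<close>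

lemma bump_approximates_measurable:
  fixes \<psi> :: "'a::euclidean_space \<Rightarrow> real"
  assumes \<psi>: "\<psi> \<in> borel_measurable lebesgue" "\<And>x. \<bar>\<psi> x\<bar> \<le> 1" "\<And>x. norm x > R \<Longrightarrow> \<psi> x = 0"
  obtains P N where "\<And>n::nat. real_polynomial_function (P n)" "\<And>n x. \<bar>bump (R + 2) 0 (P n) x\<bar> \<le> 2"
    "negligible N" "\<And>x. x \<notin> N \<Longrightarrow> (\<lambda>n. bump (R + 2) 0 (P n) x) \<longlonglongrightarrow> \<psi> x"
proof -
  have "\<psi> measurable_on UNIV" using \<psi>(1) by (simp add: lebesgue_measurable_imp_measurable_on)
  then obtain N c where N: "negligible N" and c: "\<And>n. continuous_on UNIV (c n)"
    and lim: "\<And>x. x \<notin> N \<Longrightarrow> (\<lambda>n::nat. c n x) \<longlonglongrightarrow> \<psi> x"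
    unfolding measurable_on_def by auto
  \<comment> \<open>Values are clamped to [-1,1]; the cutoff is 1 up to radius \<open>R\<close> and
    0 from \<open>R + 1\<close> on. Neither operation changes the limit \<open>\<psi>\<close>. The
    bumps live on radius \<open>R + 2\<close>, which leaves the required gap.\<close>
  define d where "d n x = max (- 1) (min 1 (c n x)) * max 0 (min 1 (R + 1 - norm x))" for n x
  have d: "continuous_on UNIV (d n)" for n
    unfolding d_def by (intro continuous_intros c)
  have d0: "d n x = 0" if "norm x > R + 1" for n x
    using that by (simp add: d_def)
  have "\<exists>P. real_polynomial_function P \<and> (\<forall>x. \<bar>bump (R + 2) 0 P x - d n x\<bar> < inverse (real (Suc n)))" for n
    by (rule bump_approximates_continuous[of "d n" "R + 1" "R + 2" "inverse (real (Suc n))"])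
      (use d d0 in auto)
  then obtain P where P: "\<And>n. real_polynomial_function (P n)"
    "\<And>n x. \<bar>bump (R + 2) 0 (P n) x - d n x\<bar> < inverse (real (Suc n))" by metis
  have bd: "\<bar>bump (R + 2) 0 (P n) x\<bar> \<le> 2" for n x
  proof -
    have "\<bar>d n x\<bar> \<le> 1 * 1" unfolding d_def abs_mult by (intro mult_mono) auto
    moreover have "inverse (real (Suc n)) \<le> 1" by (simp add: field_simps)
    ultimately show ?thesis using P(2)[of n x] by linarith
  qed
  have "(\<lambda>n. bump (R + 2) 0 (P n) x) \<longlonglongrightarrow> \<psi> x" if "x \<notin> N" for x
  proof -
    have "(\<lambda>n. d n x) \<longlonglongrightarrow> max (- 1) (min 1 (\<psi> x)) * max 0 (min 1 (R + 1 - norm x))"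
      unfolding d_def by (intro tendsto_intros lim that)
    also have "max (- 1) (min 1 (\<psi> x)) * max 0 (min 1 (R + 1 - norm x)) = \<psi> x"
      using \<psi>(2)[of x] \<psi>(3)[of x] by (cases "norm x > R") (auto simp: max_def min_def)
    finally have "(\<lambda>n. d n x) \<longlonglongrightarrow> \<psi> x" .
    moreover have "(\<lambda>n. bump (R + 2) 0 (P n) x - d n x) \<longlonglongrightarrow> 0"
      by (rule Lim_null_comparison[OF _ LIMSEQ_inverse_real_of_nat]) (use P(2) in \<open>auto intro!: always_eventually less_imp_le\<close>)
    ultimately show ?thesis using tendsto_add by fastforce
  qed
  with P(1) bd N show ?thesis by (intro that[of P N]) auto
qed

section \<open>Translation estimate in L^1 of a ball\<close>

lemma lborel_translation:
  fixes u :: "'a::euclidean_space \<Rightarrow> real"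
  assumes [measurable]: "u \<in> borel_measurable borel"
  shows "integrable lborel (\<lambda>x. u (h + x)) \<longleftrightarrow> integrable lborel u"
    "(\<integral>x. u (h + x) \<partial>lborel) = (\<integral>x. u x \<partial>lborel)"
proof -
  have "integrable (distr lborel borel ((+) h)) u \<longleftrightarrow> integrable lborel (\<lambda>x. u (h + x))"
    by (rule integrable_distr_eq) measurable
  then show "integrable lborel (\<lambda>x. u (h + x)) \<longleftrightarrow> integrable lborel u" by (simp add: lborel_distr_plus)
  have "integral\<^sup>L (distr lborel borel ((+) h)) u = (\<integral>x. u (h + x) \<partial>lborel)"
    by (rule integral_distr) measurable
  then show "(\<integral>x. u (h + x) \<partial>lborel) = (\<integral>x. u x \<partial>lborel)" by (simp add: lborel_distr_plus)
qed

text \<open>If \<open>\<psi>\<close> is the sign of the difference, cut off to the ball, the left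
  side is the integral of \<open>f x * (\<psi> (x - h) - \<psi> x)\<close> by translation
  invariance. This is the limit of the same integrals with bumps bounded by 2 in place of
  \<open>\<psi>\<close>. The bumps have radius \<open>R + 2\<close> and
  \<open>norm h \<le> 1\<close>, whence \<open>R + 3\<close>.\<close>

lemma translation_L1_le:
  fixes f :: "'a::euclidean_space \<Rightarrow> real"
  assumes f [measurable]: "f \<in> borel_measurable borel"
    and fI: "(\<integral>\<^sup>+x\<in>cball 0 (R + 3). ennreal \<bar>f x\<bar> \<partial>lborel) \<le> ennreal I" "0 \<le> I"
    and g: "weak_gradient f g" "(\<integral>\<^sup>+x\<in>cball 0 (R + 3). ennreal (norm (g x)) \<partial>lebesgue) \<le> ennreal J" "0 \<le> J"
    and h: "norm h \<le> 1"
  shows "(\<integral>\<^sup>+x\<in>cball 0 R. ennreal \<bar>f (x + h) - f x\<bar> \<partial>lborel) \<le> ennreal (2 * norm h * J)"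
proof -
  have [measurable]: "cball (0::'a) R \<in> sets borel" by simp
  define \<psi> where "\<psi> x = indicator (cball 0 R) x * sgn (f (x + h) - f x)" for x
  have \<psi>m [measurable]: "\<psi> \<in> borel_measurable borel"
    unfolding \<psi>_def sgn_if by measurable
  have \<psi>: "\<And>x. \<bar>\<psi> x\<bar> \<le> 1" "\<And>x. norm x > R \<Longrightarrow> \<psi> x = 0"
    by (auto simp: \<psi>_def indicator_def abs_sgn_eq)
  obtain P N where P: "\<And>n::nat. real_polynomial_function (P n)"
    and P2: "\<And>n x. \<bar>bump (R + 2) 0 (P n) x\<bar> \<le> 2"
    and N: "negligible N" and lim: "\<And>x. x \<notin> N \<Longrightarrow> (\<lambda>n. bump (R + 2) 0 (P n) x) \<longlonglongrightarrow> \<psi> x"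
    using bump_approximates_measurable[OF borel_measurable_lebesgueI[OF \<psi>m] \<psi>] by blast
  have [measurable]: "bump (R + 2) 0 (P n) \<in> borel_measurable borel" for n using P by measurable
  let ?\<phi> = "\<lambda>n. bump (R + 2) 0 (P n)"
  \<comment> \<open>Dominating function: two bumps, each bounded by 2, both vanishing outside radius
    \<open>R + 3\<close>.\<close>
  let ?w = "\<lambda>x. f x * (4 * indicator (cball 0 (R + 3)) x)"
  \<comment> \<open>Convergence is needed at \<open>x\<close> and at \<open>x - h\<close>, so both
    \<open>N\<close> and its translate by \<open>h\<close> are discarded.\<close>
  have ae: "AE x in lborel. x \<notin> N \<and> x - h \<notin> N"
  proof -
    have "negligible (N \<union> (+) h ` N)" by (intro negligible_Un negligible_translation N)
    then have "AE x in lebesgue. x \<notin> N \<union> (+) h ` N"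
      unfolding negligible_iff_null_sets by (rule AE_not_in)
    then have "AE x in lborel. x \<notin> N \<union> (+) h ` N"
      by (simp add: AE_completion_iff)
    moreover have "x \<in> (+) h ` N" if "x - h \<in> N" for x
      using imageI[OF that, of "(+) h"] by simp
    ultimately show ?thesis by (elim eventually_mono) blast
  qed
  have "(\<lambda>n. \<integral>x. f x * (?\<phi> n (x - h) - ?\<phi> n x) \<partial>lborel) \<longlonglongrightarrow> (\<integral>x. f x * (\<psi> (x - h) - \<psi> x) \<partial>lborel)"
  proof (rule integral_dominated_convergence[where w="\<lambda>x. \<bar>?w x\<bar>"])
    show "integrable lborel (\<lambda>x. \<bar>?w x\<bar>)"
      by (intro integrable_abs integrable_mult_bounded_support(1)[where S="cball 0 (R + 3)" and B=4, OF _ _ _ _ _ _ fI])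
        (auto simp: indicator_def)
    show "AE x in lborel. (\<lambda>n. f x * (?\<phi> n (x - h) - ?\<phi> n x)) \<longlonglongrightarrow> f x * (\<psi> (x - h) - \<psi> x)"
      using ae by eventually_elim (auto intro!: tendsto_intros lim)
    show "AE x in lborel. norm (f x * (?\<phi> n (x - h) - ?\<phi> n x)) \<le> \<bar>?w x\<bar>" for n
    proof (intro AE_I2)
      fix x
      have "\<bar>?\<phi> n (x - h) - ?\<phi> n x\<bar> \<le> 4 * indicator (cball 0 (R + 3)) x"
      proof (cases "norm x \<le> R + 3")
        case True
        then show ?thesis using P2[of n x] P2[of n "x - h"] by simp
      next
        case False
        then have "norm (x - h) \<ge> R + 2" using h norm_triangle_ineq2[of x h] by simp
        with False show ?thesis by (simp add: bump_eq_0)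
      qed
      then show "norm (f x * (?\<phi> n (x - h) - ?\<phi> n x)) \<le> \<bar>?w x\<bar>"
        by (simp add: abs_mult mult_left_mono)
    qed
  qed measurable
  then have "(\<lambda>n. \<bar>\<integral>x. f x * (?\<phi> n (x - h) - ?\<phi> n x) \<partial>lborel\<bar>) \<longlonglongrightarrow> \<bar>\<integral>x. f x * (\<psi> (x - h) - \<psi> x) \<partial>lborel\<bar>"
    by (rule tendsto_rabs)
  moreover have "\<bar>\<integral>x. f x * (?\<phi> n (x - h) - ?\<phi> n x) \<partial>lborel\<bar> \<le> 2 * norm h * J" for n
    using h by (intro translation_bump_le[OF f fI g P P2]) simp
  ultimately have le: "\<bar>\<integral>x. f x * (\<psi> (x - h) - \<psi> x) \<partial>lborel\<bar> \<le> 2 * norm h * J"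
    by (intro LIMSEQ_le_const2) auto

  have i1: "integrable lborel (\<lambda>x. f x * \<psi> (x - h))"
  proof (rule integrable_mult_bounded_support(1)[where S="cball 0 (R + 3)" and B=1, OF _ _ _ _ _ _ fI])
    show "\<psi> (x - h) = 0" if "x \<notin> cball 0 (R + 3)" for x
      using that h norm_triangle_ineq2[of x h] by (intro \<psi>(2)) simp
  qed (use \<psi> in auto)
  have i2: "integrable lborel (\<lambda>x. f x * \<psi> x)"
    by (rule integrable_mult_bounded_support(1)[where S="cball 0 (R + 3)" and B=1, OF _ _ _ _ _ _ fI])
      (use \<psi> in auto)
  have m: "(\<lambda>x. f x * \<psi> (x - h)) \<in> borel_measurable borel" by measurable
  have i3: "integrable lborel (\<lambda>x. f (x + h) * \<psi> x)"
    using lborel_translation(1)[OF m, of h] i1 by (simp add: add.commute)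
  have "(\<integral>x. f x * (\<psi> (x - h) - \<psi> x) \<partial>lborel) = (\<integral>x. f x * \<psi> (x - h) \<partial>lborel) - (\<integral>x. f x * \<psi> x \<partial>lborel)"
    using i1 i2 by (simp add: right_diff_distrib)
  also have "\<dots> = (\<integral>x. f (x + h) * \<psi> x \<partial>lborel) - (\<integral>x. f x * \<psi> x \<partial>lborel)"
    using lborel_translation(2)[OF m, of h] by (simp add: add.commute)
  also have "\<dots> = (\<integral>x. f (x + h) * \<psi> x - f x * \<psi> x \<partial>lborel)"
    using i2 i3 by simp
  also have "(\<lambda>x. f (x + h) * \<psi> x - f x * \<psi> x) = (\<lambda>x. \<bar>f (x + h) - f x\<bar> * indicator (cball 0 R) x)"
    by (auto simp: \<psi>_def indicator_def sgn_if fun_eq_iff)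
  finally have eq: "(\<integral>x. f x * (\<psi> (x - h) - \<psi> x) \<partial>lborel) = (\<integral>x. \<bar>f (x + h) - f x\<bar> * indicator (cball 0 R) x \<partial>lborel)" .
  have i4: "integrable lborel (\<lambda>x. \<bar>f (x + h) - f x\<bar> * indicator (cball 0 R) x)"
  proof -
    have "integrable lborel (\<lambda>x. f (x + h) * \<psi> x - f x * \<psi> x)" using i2 i3 by simp
    also have "(\<lambda>x. f (x + h) * \<psi> x - f x * \<psi> x) = (\<lambda>x. \<bar>f (x + h) - f x\<bar> * indicator (cball 0 R) x)"
      by (auto simp: \<psi>_def indicator_def sgn_if fun_eq_iff)
    finally show ?thesis .
  qed
  have "(\<integral>\<^sup>+x\<in>cball 0 R. ennreal \<bar>f (x + h) - f x\<bar> \<partial>lborel) = (\<integral>\<^sup>+x. ennreal (\<bar>f (x + h) - f x\<bar> * indicator (cball 0 R) x) \<partial>lborel)"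
    by (intro nn_integral_cong) (auto simp: indicator_def)
  also have "\<dots> = ennreal (\<integral>x. \<bar>f (x + h) - f x\<bar> * indicator (cball 0 R) x \<partial>lborel)"
    by (rule nn_integral_eq_integral[OF i4]) auto
  also have "\<dots> \<le> ennreal (2 * norm h * J)"
    using le unfolding eq by (intro ennreal_leI) linarith
  finally show ?thesis .
qed

section \<open>Compactness in \<open>L^1\<close> of a ball\<close>

text \<open>A normalised cone. Arzela-Ascoli will use only the boundedness and the Lipschitz
  continuity of the kernel, so smoothness is not asked for.\<close>

lemma Lipschitz_mollifier_exists:
  assumes r: "r > 0"
  obtains \<kappa> :: "'a::euclidean_space \<Rightarrow> real" and K where "\<kappa> \<in> borel_measurable borel"
    "\<And>x. 0 \<le> \<kappa> x" "\<And>x. \<kappa> x \<le> K" "\<And>x. norm x > r \<Longrightarrow> \<kappa> x = 0" "\<And>x y. \<bar>\<kappa> x - \<kappa> y\<bar> \<le> K * norm (x - y)"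
    "integrable lborel \<kappa>" "(\<integral>x. \<kappa> x \<partial>lborel) = 1" "0 \<le> K"
proof -
  define \<rho> where "\<rho> x = max 0 (r - norm x)" for x :: 'a
  define c where "c = (\<integral>x. \<rho> x \<partial>lborel)"
  have [measurable]: "\<rho> \<in> borel_measurable borel" unfolding \<rho>_def by measurable
  have int: "integrable lborel \<rho>"
  proof -
    have em: "emeasure lborel (cball (0::'a) r) = ennreal (measure lborel (cball (0::'a) r))"
      by (rule emeasure_eq_ennreal_measure) (use emeasure_lborel_cball_finite[of "0::'a" r] in auto)
    have "integrable lborel (\<lambda>x. 1 * \<rho> x)"
      by (rule integrable_mult_bounded_support(1)[where S="cball 0 r" and B=r and I="measure lborel (cball (0::'a) r)"])
        (use r in \<open>auto simp: \<rho>_def em\<close>)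
    then show ?thesis by simp
  qed
  \<comment> \<open>The cone is at least \<open>r / 2\<close> on the ball of radius
    \<open>r / 2\<close>, so its mass \<open>c\<close> is positive.\<close>
  have "0 < r / 2 * measure lborel (ball (0::'a) (r / 2))"
    using r by (simp add: content_ball_pos)
  also have "\<dots> = (\<integral>x. r / 2 * indicator (ball (0::'a) (r / 2)) x \<partial>lborel)"
    by simp
  also have "\<dots> \<le> c" unfolding c_def
  proof (rule integral_mono[OF _ int])
    show "integrable lborel (\<lambda>x. r / 2 * indicator (ball (0::'a) (r / 2)) x)"
      by (intro integrable_mult_right integrable_real_indicator emeasure_lborel_ball_finite) simp
  qed (use r in \<open>auto simp: \<rho>_def indicator_def\<close>)
  finally have c: "c > 0" .
  \<comment> \<open>One constant for both purposes: \<open>r / c\<close> is the sup bound and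
    \<open>1 / c\<close> the Lipschitz constant.\<close>
  define K where "K = max (r / c) (1 / c)"
  show ?thesis
  proof (rule that[of "\<lambda>x. \<rho> x / c" K])
    show "\<rho> x / c \<le> K" for x
    proof -
      have "\<rho> x / c \<le> r / c" using r c by (intro divide_right_mono) (auto simp: \<rho>_def)
      then show ?thesis by (simp add: K_def)
    qed
    show "\<bar>\<rho> x / c - \<rho> y / c\<bar> \<le> K * norm (x - y)" for x y
    proof -
      have "\<bar>\<rho> x - \<rho> y\<bar> \<le> norm (x - y)"
        using norm_triangle_ineq3[of x y] unfolding \<rho>_def by linarith
      then have "\<bar>\<rho> x / c - \<rho> y / c\<bar> \<le> (1 / c) * norm (x - y)"
        using c by (simp add: divide_right_mono flip: diff_divide_distrib)
      also have "\<dots> \<le> K * norm (x - y)" by (intro mult_right_mono) (auto simp: K_def)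
      finally show ?thesis .
    qed
    show "integrable lborel (\<lambda>x. \<rho> x / c)" using int by simp
    show "(\<integral>x. \<rho> x / c \<partial>lborel) = 1" using c by (simp add: c_def)
  qed (use r c int in \<open>auto simp: \<rho>_def K_def le_max_iff_disj\<close>)
qed

text \<open>Since the kernel has mass 1, the substitution y = x + h writes the difference as the
  average of f(x + h) - f(x) with weight \<open>\<kappa> h\<close>. After exchanging integrals, only
  \<open>norm h \<le> r\<close> contributes, and there \<open>L\<close> bounds the inner
  integral.\<close>

lemma L1_distance_to_mollified_le:
  fixes f :: "'a::euclidean_space \<Rightarrow> real"
  assumes f [measurable]: "f \<in> borel_measurable borel"
    and A: "(\<integral>\<^sup>+x\<in>cball 0 (R + r). ennreal \<bar>f x\<bar> \<partial>lborel) \<le> ennreal A" "0 \<le> A"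
    and L: "\<And>h. norm h \<le> r \<Longrightarrow> (\<integral>\<^sup>+x\<in>cball 0 R. ennreal \<bar>f (x + h) - f x\<bar> \<partial>lborel) \<le> ennreal L"
    and \<kappa> [measurable]: "\<kappa> \<in> borel_measurable borel"
    and \<kappa>b: "\<And>x. 0 \<le> \<kappa> x" "\<And>x. \<kappa> x \<le> K" "\<And>x. norm x > r \<Longrightarrow> \<kappa> x = 0"
    and \<kappa>i: "integrable lborel \<kappa>" "(\<integral>x. \<kappa> x \<partial>lborel) = 1"
  shows "(\<integral>\<^sup>+x\<in>cball 0 R. ennreal \<bar>f x - (\<integral>y. f y * \<kappa> (y - x) \<partial>lborel)\<bar> \<partial>lborel) \<le> ennreal L"
proof -
  have [measurable]: "cball (0::'a) R \<in> sets borel" by simp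
  have K: "0 \<le> K" using \<kappa>b(1,2)[of 0] by linarith
  have pointwise: "ennreal \<bar>f x - (\<integral>y. f y * \<kappa> (y - x) \<partial>lborel)\<bar> \<le> (\<integral>\<^sup>+h. ennreal (\<bar>f (x + h) - f x\<bar> * \<kappa> h) \<partial>lborel)"
    if x: "norm x \<le> R" for x
  proof -
    have i: "integrable lborel (\<lambda>y. f y * \<kappa> (y - x))"
    proof (rule integrable_mult_bounded_support(1)[where S="cball 0 (R + r)" and B=K, OF _ _ _ _ _ K A])
      show "\<kappa> (y - x) = 0" if "y \<notin> cball 0 (R + r)" for y
        using that x norm_triangle_ineq2[of y x] by (intro \<kappa>b) simp
    qed (use \<kappa>b in auto)
    have m: "(\<lambda>y. f y * \<kappa> (y - x)) \<in> borel_measurable borel" by measurable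
    have i': "integrable lborel (\<lambda>h. f (x + h) * \<kappa> h)"
      using lborel_translation(1)[OF m, of x] i by simp
    have i'': "integrable lborel (\<lambda>h. (f (x + h) - f x) * \<kappa> h)"
      using i' \<kappa>i by (simp add: left_diff_distrib)
    have "(\<integral>h. (f (x + h) - f x) * \<kappa> h \<partial>lborel) = (\<integral>y. f y * \<kappa> (y - x) \<partial>lborel) - f x"
      using lborel_translation(2)[OF m, of x] i' \<kappa>i by (simp add: left_diff_distrib)
    moreover have "ennreal (norm (\<integral>h. (f (x + h) - f x) * \<kappa> h \<partial>lborel)) \<le> (\<integral>\<^sup>+h. ennreal (norm ((f (x + h) - f x) * \<kappa> h)) \<partial>lborel)"
      by (rule integral_norm_bound_ennreal[OF i''])
    ultimately show ?thesis
      using \<kappa>b(1) by (simp add: abs_mult abs_minus_commute)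
  qed
  have "(\<integral>\<^sup>+x\<in>cball 0 R. ennreal \<bar>f x - (\<integral>y. f y * \<kappa> (y - x) \<partial>lborel)\<bar> \<partial>lborel)
      \<le> (\<integral>\<^sup>+x. \<integral>\<^sup>+h. ennreal (\<bar>f (x + h) - f x\<bar> * \<kappa> h) * indicator (cball 0 R) x \<partial>lborel \<partial>lborel)"
    using pointwise by (intro nn_integral_mono) (auto simp: indicator_def)
  also have "\<dots> = (\<integral>\<^sup>+h. \<integral>\<^sup>+x. ennreal (\<bar>f (x + h) - f x\<bar> * \<kappa> h) * indicator (cball 0 R) x \<partial>lborel \<partial>lborel)"
    by (rule lborel_pair.Fubini') measurable
  also have "\<dots> \<le> (\<integral>\<^sup>+h. ennreal L * ennreal (\<kappa> h) \<partial>lborel)"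
  proof (intro nn_integral_mono)
    fix h :: 'a
    have "(\<integral>\<^sup>+x. ennreal (\<bar>f (x + h) - f x\<bar> * \<kappa> h) * indicator (cball 0 R) x \<partial>lborel)
      = (\<integral>\<^sup>+x. (ennreal \<bar>f (x + h) - f x\<bar> * indicator (cball 0 R) x) * ennreal (\<kappa> h) \<partial>lborel)"
      using \<kappa>b(1) by (intro nn_integral_cong) (auto simp: ennreal_mult mult_ac)
    also have "\<dots> = (\<integral>\<^sup>+x\<in>cball 0 R. ennreal \<bar>f (x + h) - f x\<bar> \<partial>lborel) * ennreal (\<kappa> h)"
      by (rule nn_integral_multc) measurable
    also have "\<dots> \<le> ennreal L * ennreal (\<kappa> h)"
      using L[of h] \<kappa>b(3)[of h] by (cases "norm h \<le> r") (auto intro: mult_right_mono)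
    finally show "(\<integral>\<^sup>+x. ennreal (\<bar>f (x + h) - f x\<bar> * \<kappa> h) * indicator (cball 0 R) x \<partial>lborel) \<le> ennreal L * ennreal (\<kappa> h)" .
  qed
  also have "\<dots> = ennreal L * (\<integral>\<^sup>+h. ennreal (\<kappa> h) \<partial>lborel)"
    by (rule nn_integral_cmult) measurable
  also have "(\<integral>\<^sup>+h. ennreal (\<kappa> h) \<partial>lborel) = 1"
    using nn_integral_eq_integral[OF \<kappa>i(1)] \<kappa>b(1) \<kappa>i(2) by simp
  finally show ?thesis by simp
qed

text \<open>The error \<delta> is split into \<delta>/4 for mollifying each of the two functions and
  \<delta>/2 for the uniform distance of the mollified ones, integrated over the ball.\<close>

lemma L1_close_pair:
  fixes f :: "nat \<Rightarrow> 'a::euclidean_space \<Rightarrow> real"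
  assumes f [measurable]: "\<And>n. f n \<in> borel_measurable borel"
    and A: "\<And>n. (\<integral>\<^sup>+x\<in>cball 0 (R + 1). ennreal \<bar>f n x\<bar> \<partial>lborel) \<le> ennreal A" "0 \<le> A"
    and L: "\<And>n h. norm h \<le> 1 \<Longrightarrow>
      (\<integral>\<^sup>+x\<in>cball 0 R. ennreal \<bar>f n (x + h) - f n x\<bar> \<partial>lborel) \<le> ennreal (L * norm h)" "0 \<le> L"
    and \<delta>: "\<delta> > 0"
  shows "\<exists>i j. i < j \<and> (\<integral>\<^sup>+x\<in>cball 0 R. ennreal \<bar>f i x - f j x\<bar> \<partial>lborel) \<le> ennreal \<delta>"
proof -
  have [measurable]: "cball (0::'a) R \<in> sets borel" by simp
  \<comment> \<open>Small enough for \<open>L * r \<le> \<delta> / 4\<close>; \<open>L + 1\<close>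
    avoids division by 0.\<close>
  define r where "r = min 1 (\<delta> / (4 * (L + 1)))"
  have r: "0 < r" "r \<le> 1" using \<delta> L(2) by (auto simp: r_def)
  have Lr: "L * r \<le> \<delta> / 4"
  proof -
    have "L * r \<le> (L + 1) * (\<delta> / (4 * (L + 1)))"
      using L(2) r \<delta> by (intro mult_mono) (auto simp: r_def)
    also have "\<dots> = \<delta> / 4" using L(2) by (simp add: field_simps)
    finally show ?thesis .
  qed
  obtain \<kappa> :: "'a \<Rightarrow> real" and K where \<kappa> [measurable]: "\<kappa> \<in> borel_measurable borel"
    and \<kappa>b: "\<And>x. 0 \<le> \<kappa> x" "\<And>x. \<kappa> x \<le> K" "\<And>x. norm x > r \<Longrightarrow> \<kappa> x = 0"
    and \<kappa>l: "\<And>x y. \<bar>\<kappa> x - \<kappa> y\<bar> \<le> K * norm (x - y)"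
    and \<kappa>i: "integrable lborel \<kappa>" "(\<integral>x. \<kappa> x \<partial>lborel) = 1" and K: "0 \<le> K"
    using Lipschitz_mollifier_exists[OF r(1)] by blast
  define F where "F n x = (\<integral>y. f n y * \<kappa> (y - x) \<partial>lborel)" for n x
  have [measurable]: "F n \<in> borel_measurable borel" for n
    unfolding F_def by measurable
  have supp: "\<kappa> (y - x) = 0" if "norm x \<le> R" "y \<notin> cball 0 (R + 1)" for x y
    using that r norm_triangle_ineq2[of y x] by (intro \<kappa>b) simp
  \<comment> \<open>This bound and the Lipschitz bound \<open>lip\<close> do not depend on
    \<open>n\<close>: they involve only the kernel and the common L^1 bound
    \<open>A\<close>.\<close>
  have bd: "\<bar>F n x\<bar> \<le> K * A" and int: "integrable lborel (\<lambda>y. f n y * \<kappa> (y - x))" if x: "norm x \<le> R" for n x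
    unfolding F_def using supp[OF x] \<kappa>b K A
    by (auto intro!: integrable_mult_bounded_support[where S="cball 0 (R + 1)" and B=K and I=A])
  have lip: "\<bar>F n x - F n y\<bar> \<le> (K * norm (x - y)) * A" if "norm x \<le> R" "norm y \<le> R" for n x y
  proof -
    have "F n x - F n y = (\<integral>z. f n z * (\<kappa> (z - x) - \<kappa> (z - y)) \<partial>lborel)"
      unfolding F_def right_diff_distrib using int that by simp
    also have "\<bar>\<dots>\<bar> \<le> (K * norm (x - y)) * A"
      using supp that \<kappa>l[of "z - x" "z - y" for z] K A
      by (intro integrable_mult_bounded_support(2)[where S="cball 0 (R + 1)"]) (auto simp: norm_minus_commute)
    finally show ?thesis .
  qed
  have close: "(\<integral>\<^sup>+x\<in>cball 0 R. ennreal \<bar>f n x - F n x\<bar> \<partial>lborel) \<le> ennreal (\<delta> / 4)" for n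
    unfolding F_def
  proof (rule L1_distance_to_mollified_le[OF f _ A(2) _ \<kappa> \<kappa>b \<kappa>i])
    have "(\<integral>\<^sup>+x\<in>cball 0 (R + r). ennreal \<bar>f n x\<bar> \<partial>lborel) \<le> (\<integral>\<^sup>+x\<in>cball 0 (R + 1). ennreal \<bar>f n x\<bar> \<partial>lborel)"
      using r by (intro nn_integral_mono) (auto simp: indicator_def)
    then show "(\<integral>\<^sup>+x\<in>cball 0 (R + r). ennreal \<bar>f n x\<bar> \<partial>lborel) \<le> ennreal A" using A(1) by (rule order_trans)
    show "(\<integral>\<^sup>+x\<in>cball 0 R. ennreal \<bar>f n (x + h) - f n x\<bar> \<partial>lborel) \<le> ennreal (\<delta> / 4)" if h: "norm h \<le> r" for h
    proof -
      have "L * norm h \<le> \<delta> / 4" using mult_left_mono[OF h L(2)] Lr by linarith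
      with L(1)[of h n] h r show ?thesis by (meson ennreal_leI order_trans)
    qed
  qed
  define V where "V = measure lborel (cball (0::'a) R)"
  \<comment> \<open>Two members of the uniformly convergent subsequence differ by less than
    \<open>2 * e\<close> on the ball of volume \<open>V\<close>, hence by at most \<delta>/2 in
    L^1.\<close>
  define e where "e = \<delta> / (4 * (V + 1))"
  have V: "V \<ge> 0" by (simp add: V_def)
  have e: "e > 0" using V \<delta> by (simp add: e_def)
  have eV: "2 * e * V \<le> \<delta> / 2"
  proof -
    have "2 * e * V \<le> 2 * e * (V + 1)" using e by simp
    also have "\<dots> = \<delta> / 2" using V by (simp add: e_def field_simps)
    finally show ?thesis .
  qed
  obtain G k where k: "strict_mono (k :: nat \<Rightarrow> nat)"
    and conv: "\<And>e. 0 < e \<Longrightarrow> \<exists>N. \<forall>n x. n \<ge> N \<and> x \<in> cball 0 R \<longrightarrow> norm (F (k n) x - G x) < e"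
  proof (rule Arzela_Ascoli[OF compact_cball[of "0::'a" R], of F "K * A"])
    show "norm (F n x) \<le> K * A" if "x \<in> cball 0 R" for n x
      using bd that by simp
    show "\<exists>d>0. \<forall>n y. y \<in> cball 0 R \<and> norm (x - y) < d \<longrightarrow> norm (F n x - F n y) < e'"
      if "x \<in> cball 0 R" "0 < e'" for x e'
    proof (intro exI conjI allI impI)
      have KA: "0 \<le> K * A" using K A(2) by simp
      then show "0 < e' / (K * A + 1)" using that by simp
      fix n y assume y: "y \<in> cball 0 R \<and> norm (x - y) < e' / (K * A + 1)"
      have "\<bar>F n x - F n y\<bar> \<le> K * A * norm (x - y)" using lip[of x y n] that y by (simp add: mult_ac)
      also have "\<dots> \<le> (K * A + 1) * norm (x - y)" by (intro mult_right_mono) auto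
      also have "\<dots> < e'" using y KA by (simp add: pos_less_divide_eq mult.commute)
      finally show "norm (F n x - F n y) < e'" by simp
    qed
  qed blast
  from conv[OF e] obtain N where N: "\<And>n x. n \<ge> N \<Longrightarrow> norm x \<le> R \<Longrightarrow> \<bar>F (k n) x - G x\<bar> < e" by auto
  define i j where "i = k N" and "j = k (Suc N)"
  have "i < j" using k by (simp add: i_def j_def strict_mono_less)
  have "(\<integral>\<^sup>+x\<in>cball 0 R. ennreal \<bar>f i x - f j x\<bar> \<partial>lborel)
      \<le> (\<integral>\<^sup>+x. ennreal \<bar>f i x - F i x\<bar> * indicator (cball 0 R) x + (ennreal \<bar>f j x - F j x\<bar> * indicator (cball 0 R) x
          + ennreal (2 * e) * indicator (cball 0 R) x) \<partial>lborel)"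
  proof (intro nn_integral_mono)
    fix x :: 'a
    have "\<bar>f i x - f j x\<bar> \<le> \<bar>f i x - F i x\<bar> + (\<bar>f j x - F j x\<bar> + 2 * e)" if "norm x \<le> R"
      using N[of N x] N[of "Suc N" x] that unfolding i_def j_def by linarith
    then show "ennreal \<bar>f i x - f j x\<bar> * indicator (cball 0 R) x \<le> ennreal \<bar>f i x - F i x\<bar> * indicator (cball 0 R) x
        + (ennreal \<bar>f j x - F j x\<bar> * indicator (cball 0 R) x + ennreal (2 * e) * indicator (cball 0 R) x)"
      using e by (auto simp: indicator_def simp flip: ennreal_plus)
  qed
  also have "\<dots> = (\<integral>\<^sup>+x\<in>cball 0 R. ennreal \<bar>f i x - F i x\<bar> \<partial>lborel) + ((\<integral>\<^sup>+x\<in>cball 0 R. ennreal \<bar>f j x - F j x\<bar> \<partial>lborel)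
      + ennreal (2 * e) * emeasure lborel (cball (0::'a) R))"
    by (simp add: nn_integral_add nn_integral_cmult)
  also have "emeasure lborel (cball (0::'a) R) = ennreal V"
    unfolding V_def by (rule emeasure_eq_ennreal_measure) (use emeasure_lborel_cball_finite[of "0::'a" R] in auto)
  also have "(\<integral>\<^sup>+x\<in>cball 0 R. ennreal \<bar>f i x - F i x\<bar> \<partial>lborel) + ((\<integral>\<^sup>+x\<in>cball 0 R. ennreal \<bar>f j x - F j x\<bar> \<partial>lborel)
      + ennreal (2 * e) * ennreal V) \<le> ennreal (\<delta> / 4) + (ennreal (\<delta> / 4) + ennreal (\<delta> / 2))"
    using e V eV by (intro add_mono close) (auto simp: ennreal_mult[symmetric] intro!: ennreal_leI)
  also have "\<dots> = ennreal \<delta>"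
    using \<delta> by (simp flip: ennreal_plus)
  finally show ?thesis using \<open>i < j\<close> by blast
qed

section \<open>Local integrability and the metric of \<open>\<Lambda>^p\<close>\<close>

lemma weak_Lq_norm_distribution_le:
  assumes C: "weak_Lq_norm q g \<le> ereal C" and t: "t > 0" and q: "q > 0"
  shows "emeasure lebesgue {x. norm (g x) > t} \<le> ennreal ((C / t) powr q)"
proof -
  let ?E = "{x. norm (g x) > t}"
  have "(if emeasure lebesgue ?E = \<infinity> then \<infinity> else ereal (t * measure lebesgue ?E powr (1 / q))) \<le> ereal C"
    using C t unfolding weak_Lq_norm_def SUP_le_iff by auto
  \<comment> \<open>The infinite branch of the definition is excluded because \<open>C\<close> is
    real. This matters since \<open>measure\<close> is 0 on sets of infinite measure.\<close>
  then have fin: "emeasure lebesgue ?E \<noteq> \<infinity>" and le: "t * measure lebesgue ?E powr (1 / q) \<le> C"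
    by (auto split: if_splits)
  from le have "measure lebesgue ?E powr (1 / q) \<le> C / t" using t by (simp add: field_simps)
  then have "(measure lebesgue ?E powr (1 / q)) powr q \<le> (C / t) powr q"
    using q by (intro powr_mono2) auto
  then have "measure lebesgue ?E \<le> (C / t) powr q" using q by (simp add: powr_powr)
  then show ?thesis using fin by (simp add: emeasure_eq_ennreal_measure ennreal_leI)
qed

text \<open>A dyadic layer-cake bound: if 2^n < a \<le> 2^(n+1), the terms with k \<le> n are all
  present and add up to 2^(n+1) - 1.\<close>

lemma le_one_plus_dyadic_sum:
  fixes a :: real
  shows "ennreal a \<le> 1 + (\<Sum>k. ennreal (2 ^ k) * indicator {b. b > 2 ^ k} a)"
proof -
  have "ennreal a \<le> 1 + (\<Sum>k<n. ennreal (2 ^ k) * indicator {b. b > 2 ^ k} a)" if "a \<le> 2 ^ n" for n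
    using that
  proof (induction n)
    case 0
    then have "ennreal a \<le> ennreal 1" by (intro ennreal_leI) simp
    then show ?case by simp
  next
    case (Suc n)
    show ?case
    proof (cases "a \<le> 2 ^ n")
      case True
      have "(\<Sum>k<n. ennreal (2 ^ k) * indicator {b. b > 2 ^ k} a) \<le> (\<Sum>k<Suc n. ennreal (2 ^ k) * indicator {b. b > 2 ^ k} a)"
        by simp
      with Suc.IH[OF True] show ?thesis by (meson add_left_mono order_trans)
    next
      case False
      have "2 ^ k < a" if "k < Suc n" for k
      proof -
        have "(2::real) ^ k \<le> 2 ^ n" using that by (intro power_increasing) auto
        with False show ?thesis by linarith
      qed
      then have "(\<Sum>k<Suc n. ennreal (2 ^ k) * indicator {b. b > 2 ^ k} a) = (\<Sum>k<Suc n. ennreal (2 ^ k))"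
        by (intro sum.cong) auto
      also have "\<dots> = ennreal (\<Sum>k<Suc n. 2 ^ k)" by (rule sum_ennreal) simp
      also have "(\<Sum>k<Suc n. 2 ^ k :: real) = 2 ^ Suc n - 1" by (induction n) auto
      finally have eq: "(\<Sum>k<Suc n. ennreal (2 ^ k) * indicator {b. b > 2 ^ k} a) = ennreal (2 ^ Suc n - 1)" .
      have "ennreal a \<le> ennreal (1 + (2 ^ Suc n - 1))"
        using Suc.prems by (intro ennreal_leI) simp
      also have "\<dots> = ennreal 1 + ennreal (2 ^ Suc n - 1)"
        using one_le_power[of "2::real" "Suc n"] by (intro ennreal_plus) linarith+
      finally show ?thesis unfolding eq by simp
    qed
  qed
  moreover obtain n where "a \<le> 2 ^ n"
    using real_arch_pow[of 2 a] by (auto intro: less_imp_le)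
  moreover have "(\<Sum>k<n. ennreal (2 ^ k) * indicator {b. b > 2 ^ k} a) \<le> (\<Sum>k. ennreal (2 ^ k) * indicator {b. b > 2 ^ k} a)"
    by (rule sum_le_suminf) auto
  ultimately show ?thesis by (meson add_left_mono order_trans)
qed

text \<open>Heights up to 1 cost at most the measure of \<open>S\<close>. The dyadic level 2^k costs
  at most 2^k (C / 2^k)^q = C^q (2^(1-q))^k, a geometric series that converges exactly because q >
  1.\<close>

lemma nn_integral_le_weak_Lq:
  fixes g :: "'a::euclidean_space \<Rightarrow> 'b::euclidean_space"
  assumes g [measurable]: "g \<in> borel_measurable lebesgue" and S [measurable]: "S \<in> sets lebesgue"
    and C: "weak_Lq_norm q g \<le> ereal C" "0 \<le> C" and q: "1 < q"
  shows "(\<integral>\<^sup>+x\<in>S. ennreal (norm (g x)) \<partial>lebesgue)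
    \<le> emeasure lebesgue S + ennreal (C powr q / (1 - 2 powr (1 - q)))"
proof -
  let ?E = "\<lambda>k::nat. {x. norm (g x) > 2 ^ k}"
  have E [measurable]: "?E k \<in> sets lebesgue" for k
    using measurable_sets[OF measurable_compose[OF g borel_measurable_norm], of "{2 ^ k<..}"] by (simp add: vimage_def)
  have "(\<integral>\<^sup>+x\<in>S. ennreal (norm (g x)) \<partial>lebesgue)
      \<le> (\<integral>\<^sup>+x. indicator S x + (\<Sum>k. ennreal (2 ^ k) * indicator (?E k) x) \<partial>lebesgue)"
  proof (intro nn_integral_mono)
    fix x
    show "ennreal (norm (g x)) * indicator S x \<le> indicator S x + (\<Sum>k. ennreal (2 ^ k) * indicator (?E k) x)"
      using le_one_plus_dyadic_sum[of "norm (g x)"] by (simp add: indicator_def)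
  qed
  also have "\<dots> = emeasure lebesgue S + (\<Sum>k. ennreal (2 ^ k) * emeasure lebesgue (?E k))"
    by (simp add: nn_integral_add nn_integral_suminf nn_integral_cmult)
  also have "(\<Sum>k. ennreal (2 ^ k) * emeasure lebesgue (?E k)) \<le> (\<Sum>k. ennreal (C powr q * (2 powr (1 - q)) ^ k))"
  proof (rule suminf_le)
    fix k
    have "ennreal (2 ^ k) * emeasure lebesgue (?E k) \<le> ennreal (2 ^ k) * ennreal ((C / 2 ^ k) powr q)"
      using q by (intro mult_left_mono weak_Lq_norm_distribution_le[OF C(1)]) auto
    also have "\<dots> = ennreal (2 ^ k * (C / 2 ^ k) powr q)"
      by (simp add: ennreal_mult)
    also have "2 ^ k * (C / 2 ^ k) powr q = C powr q * (2 powr (1 - q)) ^ k"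
    proof -
      have "(2 powr (1 - q)) ^ k = 2 powr real k / 2 powr (q * real k)"
        by (simp add: powr_realpow[symmetric] powr_powr powr_diff[symmetric] algebra_simps)
      also have "\<dots> = 2 ^ k / (2 ^ k) powr q"
        by (simp add: powr_powr mult.commute flip: powr_realpow)
      finally show ?thesis using C(2) by (simp add: powr_divide)
    qed
    finally show "ennreal (2 ^ k) * emeasure lebesgue (?E k) \<le> ennreal (C powr q * (2 powr (1 - q)) ^ k)" .
  qed auto
  also have "(\<Sum>k. ennreal (C powr q * (2 powr (1 - q)) ^ k)) = ennreal (C powr q / (1 - 2 powr (1 - q)))"
  proof (rule suminf_ennreal_eq)
    have "2 powr (1 - q) < 1" using q powr_less_mono[of "1 - q" 0 2] by simp
    then show "(\<lambda>k. C powr q * (2 powr (1 - q)) ^ k) sums (C powr q / (1 - 2 powr (1 - q)))"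
      using sums_mult[OF geometric_sums[of "2 powr (1 - q)"], of "C powr q"] by simp
  qed simp
  finally show ?thesis by (simp add: add_left_mono)
qed

text \<open>Integrates \<open>\<bar>f x\<bar> \<le> 1 + \<bar>f x\<bar> powr p\<close> over
  \<open>S\<close>, instead of invoking Hoelder's inequality; the constant only has to be uniform in
  the family.\<close>

lemma nn_integral_le_Lp:
  fixes f :: "'a::euclidean_space \<Rightarrow> real"
  assumes f: "Lp_fun p f" and C: "Lp_norm p f \<le> C" and p: "1 \<le> p" and S [measurable]: "S \<in> sets lebesgue"
  shows "(\<integral>\<^sup>+x\<in>S. ennreal \<bar>f x\<bar> \<partial>lebesgue) \<le> emeasure lebesgue S + ennreal (C powr p)"
proof -
  have [measurable]: "f \<in> borel_measurable lebesgue" and fin: "(\<integral>\<^sup>+ x. ennreal (\<bar>f x\<bar> powr p) \<partial>lebesgue) < \<infinity>"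
    using f by (auto simp: Lp_fun_def)
  let ?X = "\<integral>\<^sup>+ x. ennreal (\<bar>f x\<bar> powr p) \<partial>lebesgue"
  have "(enn2real ?X powr (1 / p)) powr p \<le> C powr p"
    using C p by (intro powr_mono2) (auto simp: Lp_norm_def)
  then have "enn2real ?X \<le> C powr p" using p by (simp add: powr_powr)
  \<comment> \<open>Finiteness is used here: \<open>enn2real\<close> sends infinity to 0, so a bound
    on it alone would say nothing.\<close>
  then have X: "?X \<le> ennreal (C powr p)" using fin by (metis ennreal_enn2real ennreal_leI infinity_ennreal_def)
  have "(\<integral>\<^sup>+x\<in>S. ennreal \<bar>f x\<bar> \<partial>lebesgue) \<le> (\<integral>\<^sup>+x. indicator S x + ennreal (\<bar>f x\<bar> powr p) \<partial>lebesgue)"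
  proof (intro nn_integral_mono)
    fix x
    have "\<bar>f x\<bar> \<le> 1 + \<bar>f x\<bar> powr p"
    proof (cases "\<bar>f x\<bar> \<le> 1")
      case False
      then have "\<bar>f x\<bar> powr 1 \<le> \<bar>f x\<bar> powr p" using p by (intro powr_mono) auto
      then show ?thesis by simp
    qed (simp add: add_increasing2)
    then have "ennreal \<bar>f x\<bar> \<le> 1 + ennreal (\<bar>f x\<bar> powr p)"
      by (metis ennreal_1 ennreal_leI ennreal_plus powr_ge_zero zero_le_one)
    then show "ennreal \<bar>f x\<bar> * indicator S x \<le> indicator S x + ennreal (\<bar>f x\<bar> powr p)"
      by (simp add: indicator_def)
  qed
  also have "\<dots> = emeasure lebesgue S + ?X"
    by (simp add: nn_integral_add)
  also have "\<dots> \<le> emeasure lebesgue S + ennreal (C powr p)"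
    using X by (rule add_left_mono)
  finally show ?thesis .
qed

section \<open>Truncated powers and the distance\<close>

lemma min_powr_le:
  fixes a p :: real
  assumes "0 \<le> a" "1 \<le> p"
  shows "min a 1 powr p \<le> a"
proof -
  have "min a 1 powr p \<le> min a 1 powr 1" using assms by (intro powr_mono') auto
  also have "\<dots> = min a 1" using assms by (intro powr_one) auto
  finally show ?thesis by simp
qed

text \<open>The tail hypothesis controls each function separately, whereas the metric sees the
  difference. It is compared with twice the larger truncation, whence
  \<open>2 powr p\<close>.\<close>

lemma min_diff_powr_le:
  fixes a b p :: real
  assumes "1 \<le> p"
  shows "min \<bar>a - b\<bar> 1 powr p \<le> 2 powr p * (min \<bar>a\<bar> 1 powr p + min \<bar>b\<bar> 1 powr p)"
proof -
  let ?m = "max (min \<bar>a\<bar> 1) (min \<bar>b\<bar> 1)"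
  have "min \<bar>a - b\<bar> 1 \<le> 2 * ?m" by (auto simp: min_def max_def)
  then have "min \<bar>a - b\<bar> 1 powr p \<le> (2 * ?m) powr p" using assms by (intro powr_mono2) auto
  also have "\<dots> = 2 powr p * ?m powr p" by (simp add: powr_mult)
  also have "\<dots> \<le> 2 powr p * (min \<bar>a\<bar> 1 powr p + min \<bar>b\<bar> 1 powr p)"
    by (intro mult_left_mono) (auto simp: max_def)
  finally show ?thesis .
qed

text \<open>The ball contributes at most e^p/4. The exterior contributes at most 2^p times two tails
  of e^p/(8 * 2^p), which is again e^p/4. The total e^p/2 leaves room for the strict
  inequality.\<close>

lemma Lambda_dist_less:
  fixes u v :: "'a::euclidean_space \<Rightarrow> real"
  assumes [measurable]: "u \<in> borel_measurable lebesgue" "v \<in> borel_measurable lebesgue"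
    and p: "1 \<le> p" and e: "0 < e"
    and near: "(\<integral>\<^sup>+x\<in>cball 0 R. ennreal \<bar>u x - v x\<bar> \<partial>lebesgue) \<le> ennreal (e powr p / 4)"
    and far: "(\<integral>\<^sup>+x\<in>{x. norm x > R}. ennreal (min \<bar>u x\<bar> 1 powr p) \<partial>lebesgue) \<le> ennreal (e powr p / (8 * 2 powr p))"
      "(\<integral>\<^sup>+x\<in>{x. norm x > R}. ennreal (min \<bar>v x\<bar> 1 powr p) \<partial>lebesgue) \<le> ennreal (e powr p / (8 * 2 powr p))"
  shows "Lambda_dist p u v < e"
proof -
  let ?F = "{x::'a. norm x > R}"
  have F: "?F = - cball 0 R" by auto
  have [measurable]: "cball (0::'a) R \<in> sets lebesgue" "?F \<in> sets lebesgue"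
    unfolding F by (simp_all add: lmeasurable_iff_integrable del: Compl_iff)
  let ?X = "\<integral>\<^sup>+x. ennreal (min \<bar>u x - v x\<bar> 1 powr p) \<partial>lebesgue"
  have "?X \<le> (\<integral>\<^sup>+x. ennreal \<bar>u x - v x\<bar> * indicator (cball 0 R) x + ennreal (2 powr p) *
      (ennreal (min \<bar>u x\<bar> 1 powr p) * indicator ?F x + ennreal (min \<bar>v x\<bar> 1 powr p) * indicator ?F x) \<partial>lebesgue)"
  proof (intro nn_integral_mono)
    fix x :: 'a
    show "ennreal (min \<bar>u x - v x\<bar> 1 powr p) \<le> ennreal \<bar>u x - v x\<bar> * indicator (cball 0 R) x + ennreal (2 powr p) *
      (ennreal (min \<bar>u x\<bar> 1 powr p) * indicator ?F x + ennreal (min \<bar>v x\<bar> 1 powr p) * indicator ?F x)"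
      using min_powr_le[OF abs_ge_zero p, of "u x - v x"] min_diff_powr_le[OF p, of "u x" "v x"]
      by (cases "norm x \<le> R") (auto simp: indicator_def ennreal_mult[symmetric] ennreal_leI simp flip: ennreal_plus)
  qed
  also have "\<dots> = (\<integral>\<^sup>+x\<in>cball 0 R. ennreal \<bar>u x - v x\<bar> \<partial>lebesgue) + ennreal (2 powr p) *
     ((\<integral>\<^sup>+x\<in>?F. ennreal (min \<bar>u x\<bar> 1 powr p) \<partial>lebesgue) + (\<integral>\<^sup>+x\<in>?F. ennreal (min \<bar>v x\<bar> 1 powr p) \<partial>lebesgue))"
    by (simp add: nn_integral_add nn_integral_cmult)
  also have "\<dots> \<le> ennreal (e powr p / 4) + ennreal (2 powr p) * (ennreal (e powr p / (8 * 2 powr p)) + ennreal (e powr p / (8 * 2 powr p)))"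
    by (intro add_mono mult_left_mono near far) auto
  also have "\<dots> = ennreal (e powr p / 4 + 2 powr p * (e powr p / (8 * 2 powr p) + e powr p / (8 * 2 powr p)))"
    by (subst ennreal_plus[symmetric], simp, simp, subst ennreal_mult[symmetric], simp, simp, subst ennreal_plus[symmetric]) auto
  also have "e powr p / 4 + 2 powr p * (e powr p / (8 * 2 powr p) + e powr p / (8 * 2 powr p)) = e powr p / 2"
    by (simp add: field_simps)
  finally have "enn2real ?X \<le> e powr p / 2" by (rule enn2real_leI[rotated]) simp
  also have "\<dots> < e powr p" using e by simp
  finally have "enn2real ?X powr (1 / p) < (e powr p) powr (1 / p)"
    using p by (intro powr_less_mono2) auto
  also have "\<dots> = e" using p e by (simp add: powr_powr)
  finally show ?thesis by (simp add: Lambda_dist_def)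
qed

text \<open>Allows the passage to Borel representatives, on which the Fubini and translation
  arguments over \<open>lborel\<close> operate.\<close>

lemma weak_gradient_cong_AE:
  fixes f f' :: "'a::euclidean_space \<Rightarrow> real"
  assumes g: "weak_gradient f g" and f: "f \<in> borel_measurable lebesgue" "f' \<in> borel_measurable lebesgue"
    and ae: "AE x in lebesgue. f x = f' x"
  shows "weak_gradient f' g"
proof -
  have "(\<integral>x. f' x * frechet_derivative \<phi> (at x) i \<partial>lebesgue) = (\<integral>x. f x * frechet_derivative \<phi> (at x) i \<partial>lebesgue)"
    if "test_fun \<phi>" for \<phi> :: "'a \<Rightarrow> real" and i
  proof (rule integral_cong_AE)
    have "\<phi> \<in> Ck (Suc 0)" using that unfolding test_fun_def by blast
    then have "continuous_on UNIV (\<lambda>x. frechet_derivative \<phi> (at x) i)" by simp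
    then have "(\<lambda>x. frechet_derivative \<phi> (at x) i) \<in> borel_measurable lebesgue"
      by (intro borel_measurable_lebesgueI borel_measurable_continuous_onI)
    then show "(\<lambda>x. f' x * frechet_derivative \<phi> (at x) i) \<in> borel_measurable lebesgue"
      "(\<lambda>x. f x * frechet_derivative \<phi> (at x) i) \<in> borel_measurable lebesgue"
      using f by simp_all
    show "AE x in lebesgue. f' x * frechet_derivative \<phi> (at x) i = f x * frechet_derivative \<phi> (at x) i"
      using ae by eventually_elim simp
  qed
  with g show ?thesis unfolding weak_gradient_def by simp
qed

section \<open>Separated sequences and total boundedness\<close>

text \<open>For some \<open>e\<close>, no finite subset of \<open>F\<close> is an
  \<open>e\<close>-net, so each finite list of chosen members can be extended by one that keeps
  distance at least \<open>e\<close> from all of them.\<close>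

lemma separated_sequence_exists:
  assumes "\<not> Lambda_totally_bounded p F"
  obtains e s where "e > 0" "\<And>n::nat. s n \<in> F" "\<And>i j. i < j \<Longrightarrow> e \<le> Lambda_dist p (s j) (s i)"
proof -
  obtain e where e: "e > 0" and far: "\<And>K. finite K \<Longrightarrow> K \<subseteq> F \<Longrightarrow> \<exists>f\<in>F. \<forall>k\<in>K. e \<le> Lambda_dist p f k"
    using assms unfolding Lambda_totally_bounded_def by (metis not_le)
  have "\<exists>s. \<forall>n::nat. s n \<in> F \<and> (\<forall>m<n. e \<le> Lambda_dist p (s n) (s m))"
  proof (rule dependent_wellorder_choice)
    fix n :: nat and s assume "\<And>m. m < n \<Longrightarrow> s m \<in> F \<and> (\<forall>k<m. e \<le> Lambda_dist p (s m) (s k))"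
    then have "s ` {..<n} \<subseteq> F" by auto
    with far[of "s ` {..<n}"] show "\<exists>r. r \<in> F \<and> (\<forall>m<n. e \<le> Lambda_dist p r (s m))" by auto
  qed auto
  with e that show ?thesis by blast
qed

theorem theorem1p2:
  fixes p q C :: real and F :: "(real ^ 'n \<Rightarrow> real) set"
  assumes p: "1 \<le> p"
    and W: "\<forall>f\<in>F. W1p p f"
    and C: "C > 0" and q: "1 < q"
    and bound: "\<forall>f\<in>F. \<exists>g. weak_gradient f g \<and>
                   ereal (Lp_norm p f) + weak_Lq_norm q g \<le> ereal C"
    and tail: "\<forall>e>0. \<exists>R>0. \<forall>f\<in>F.
                 (\<integral>\<^sup>+ x\<in>{x. norm x > R}. ennreal (min \<bar>f x\<bar> 1 powr p) \<partial>lebesgue)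
                   < ennreal (e powr p)"
  shows "Lambda_totally_bounded p F"
proof (rule ccontr)
  assume "\<not> Lambda_totally_bounded p F"
  then obtain e s where e: "e > 0" and s: "\<And>n::nat. s n \<in> F"
    and sep: "\<And>i j. i < j \<Longrightarrow> e \<le> Lambda_dist p (s j) (s i)"
    using separated_sequence_exists by blast
  \<comment> \<open>Chosen so that \<open>\<epsilon> powr p\<close> is exactly the tail allowed in
    \<open>Lambda_dist_less\<close>.\<close>
  define \<epsilon> where "\<epsilon> = (e powr p / (8 * 2 powr p)) powr (1 / p)"
  have \<epsilon>: "\<epsilon> > 0" "\<epsilon> powr p = e powr p / (8 * 2 powr p)"
    using e p by (auto simp: \<epsilon>_def powr_powr)
  obtain R where "\<forall>f\<in>F.
      (\<integral>\<^sup>+ x\<in>{x. norm x > R}. ennreal (min \<bar>f x\<bar> 1 powr p) \<partial>lebesgue) < ennreal (\<epsilon> powr p)"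
    using tail[rule_format, OF \<epsilon>(1)] by blast
  then have R: "f \<in> F \<Longrightarrow>
      (\<integral>\<^sup>+ x\<in>{x. norm x > R}. ennreal (min \<bar>f x\<bar> 1 powr p) \<partial>lebesgue) \<le> ennreal (e powr p / (8 * 2 powr p))" for f
    unfolding \<epsilon>(2) by (auto intro: less_imp_le)
  have Lp: "Lp_fun p (s n)" for n using W s by (auto simp: W1p_def)
  then have sm [measurable]: "s n \<in> borel_measurable lebesgue" for n by (auto simp: Lp_fun_def)
  have "\<exists>g. weak_gradient (s n) g \<and> Lp_norm p (s n) \<le> C \<and> weak_Lq_norm q g \<le> ereal C" for n
  proof -
    obtain g where g: "weak_gradient (s n) g" "ereal (Lp_norm p (s n)) + weak_Lq_norm q g \<le> ereal C"
      using bound s by blast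
    have "0 \<le> Lp_norm p (s n)" by (simp add: Lp_norm_def)
    \<comment> \<open>As both summands are nonnegative, the bound on the sum bounds each of
      them.\<close>
    moreover have "0 \<le> weak_Lq_norm q g"
      unfolding weak_Lq_norm_def by (rule SUP_upper2[of 1]) auto
    ultimately show ?thesis using g by (cases "weak_Lq_norm q g") auto
  qed
  then obtain g where g: "\<And>n. weak_gradient (s n) (g n)" and sC: "\<And>n. Lp_norm p (s n) \<le> C"
    and gC: "\<And>n. weak_Lq_norm q (g n) \<le> ereal C" by metis
  have "\<forall>n. \<exists>f'. f' \<in> borel_measurable borel \<and> (AE x in lborel. s n x = f' x)"
    using completion_ex_borel_measurable_real[OF sm] by auto
  from choice[OF this] obtain f
    where f: "\<And>n. f n \<in> borel_measurable borel" and ae: "\<And>n. AE x in lborel. s n x = f n x"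
    by blast
  have fg: "weak_gradient (f n) (g n)" for n
    by (rule weak_gradient_cong_AE[OF g sm borel_measurable_lebesgueI[OF f]]) (rule AE_completion[OF ae])
  define V where "V = measure lebesgue (cball (0::real^'n) (R + 3))"
  have V: "emeasure lebesgue (cball (0::real^'n) (R + 3)) = ennreal V" "0 \<le> V"
    unfolding V_def using emeasure_lborel_cball_finite[of "0::real^'n" "R + 3"]
    by (auto intro!: emeasure_eq_ennreal_measure)
  \<comment> \<open>Common L^1 bounds for the functions and the gradients on the enlarged ball;
    neither depends on \<open>n\<close>. The radius \<open>R + 3\<close> is the one the translation
    estimate asks for.\<close>
  define I J where "I = V + C powr p" and "J = V + C powr q / (1 - 2 powr (1 - q))"
  have "2 powr (1 - q) < 1" using q powr_less_mono[of "1 - q" 0 2] by simp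
  then have IJ: "0 \<le> I" "0 \<le> J" "ennreal I = ennreal V + ennreal (C powr p)"
    "ennreal J = ennreal V + ennreal (C powr q / (1 - 2 powr (1 - q)))"
    using V(2) by (auto simp: I_def J_def ennreal_plus)
  have fI: "(\<integral>\<^sup>+x\<in>cball 0 (R + 3). ennreal \<bar>f n x\<bar> \<partial>lborel) \<le> ennreal I" for n
  proof -
    have "(\<integral>\<^sup>+x\<in>cball 0 (R + 3). ennreal \<bar>f n x\<bar> \<partial>lborel) = (\<integral>\<^sup>+x\<in>cball 0 (R + 3). ennreal \<bar>s n x\<bar> \<partial>lebesgue)"
      unfolding nn_integral_completion using ae[of n] by (intro nn_integral_cong_AE) (auto elim: eventually_mono)
    also have "\<dots> \<le> ennreal I"
      using nn_integral_le_Lp[OF Lp sC p, of "cball 0 (R + 3)" n] by (simp add: V IJ)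
    finally show ?thesis .
  qed
  have gJ: "(\<integral>\<^sup>+x\<in>cball 0 (R + 3). ennreal (norm (g n x)) \<partial>lebesgue) \<le> ennreal J" for n
    using nn_integral_le_weak_Lq[OF _ _ gC _ q, of n "cball 0 (R + 3)"] g[of n] C
    by (simp add: V IJ weak_gradient_def)
  have "\<exists>i j. i < j \<and> (\<integral>\<^sup>+x\<in>cball 0 R. ennreal \<bar>f i x - f j x\<bar> \<partial>lborel) \<le> ennreal (e powr p / 4)"
  proof (rule L1_close_pair[OF f _ IJ(1)])
    show "(\<integral>\<^sup>+x\<in>cball 0 (R + 1). ennreal \<bar>f n x\<bar> \<partial>lborel) \<le> ennreal I" for n
      by (rule order_trans[OF _ fI[of n]], intro nn_integral_mono) (auto simp: indicator_def)
    show "(\<integral>\<^sup>+x\<in>cball 0 R. ennreal \<bar>f n (x + h) - f n x\<bar> \<partial>lborel) \<le> ennreal (2 * J * norm h)"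
      if "norm h \<le> 1" for n h
      using translation_L1_le[OF f fI IJ(1) fg gJ IJ(2) that, of n] by (simp add: mult_ac)
  qed (use IJ e in auto)
  then obtain i j where "i < j" and ij: "(\<integral>\<^sup>+x\<in>cball 0 R. ennreal \<bar>f i x - f j x\<bar> \<partial>lborel) \<le> ennreal (e powr p / 4)"
    by blast
  have "(\<integral>\<^sup>+x\<in>cball 0 R. ennreal \<bar>s j x - s i x\<bar> \<partial>lebesgue) = (\<integral>\<^sup>+x\<in>cball 0 R. ennreal \<bar>f i x - f j x\<bar> \<partial>lborel)"
    unfolding nn_integral_completion
  proof (rule nn_integral_cong_AE)
    show "AE x in lborel. ennreal \<bar>s j x - s i x\<bar> * indicator (cball 0 R) x = ennreal \<bar>f i x - f j x\<bar> * indicator (cball 0 R) x"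
      using ae[of i] ae[of j] by eventually_elim (simp add: abs_minus_commute)
  qed
  with ij have "Lambda_dist p (s j) (s i) < e"
    by (intro Lambda_dist_less[OF sm sm p e _ R R]) (auto simp: s)
  with sep[OF \<open>i < j\<close>] show False by simp
qed

end
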